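(* Let $\mathcal C$ be a hereditary class of (finite) graphs, and let $\theta\ge1$ be an integer. Let $\mathcal G$ be a class of (finite) graphs such that for every $G\in\mathcal G$ there exists a tree-decomposition $(T,(X_t)_{t\in V(T)})$ of $G$ of adhesion at most $\theta$ such that $\mathcal C$ contains all graphs which can be obtained from any $G[X_t]$ by adding, for each neighbour $t'$ of $t$ in $T$, a set of new vertices whose neighbourhoods are contained in $X_t\cap X_{t'}$. Then $\mathrm{asdim}(\mathcal G)\le\max\{\mathrm{asdim}(\mathcal C),1\}$.
   Context: All graphs are finite and simple, regarded as metric spaces with shortest-path distance. A class is hereditary if it is closed under taking induced subgraphs. A tree-decomposition of $G$ is a pair $(T,(X_t)_{t\in V(T)})$ with $T$ a tree and bags $X_t\subseteq V(G)$ such that $\bigcup_t X_t=V(G)$, every edge has both ends in some bag, and for each vertex $v$ the set $\{t: v\in X_t\}$ induces a connected subtree; its adhesion is $\max_{tt'\in E(T)}|X_t\cap X_{t'}|$. For a metric space, a family $\mathcal U$ of subsets is $D$-bounded if each member has diameter at most $D$, and $r$-disjoint if points in different members are at distance $>r$. $D_X:\mathbb{R}^+\to\mathbb{R}^+$ is an $n$-dimensional control function if for every $r>0$ there is a cover $\bigcup_{i=1}^{n+1}\mathcal U_i$ with each $\mathcal U_i$ $r$-disjoint and each member $D_X(r)$-bounded; $\mathrm{asdim}$ of a class is the least $n$ with a single such function valid for all members. *)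

theory Defs
  imports
    "Graph_Theory.Digraph_Component"
    "Graph_Theory.Shortest_Path"
    "HOL-Library.Extended_Nat"
    "HOL-Library.Infinite_Typeclass"
    "HOL-Library.Disjoint_Sets"
begin

text \<open>
  Finite simple graphs are the \<^locale>\<open>pair_graph\<close>s of the AFP entry Graph_Theory: an undirected
  edge is a pair of opposite arcs. The empty graph is allowed. A class of graphs is a set
  of graphs whose vertices come from one fixed type, which is infinite in the theorem, so that every
  finite graph has isomorphic copies on it and new vertices are always available. Classes are not
  required to be closed under isomorphism.
\<close>

definition graph_class :: "'v pair_pre_digraph set \<Rightarrow> bool" where
  "graph_class \<C> \<longleftrightarrow> (\<forall>G\<in>\<C>. pair_graph G)"

definition hereditary :: "'v pair_pre_digraph set \<Rightarrow> bool" where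
  "hereditary \<C> \<longleftrightarrow>
     (\<forall>G\<in>\<C>. \<forall>H. induced_subgraph (with_proj H) (with_proj G) \<longrightarrow> H \<in> \<C>)"

definition neighbours :: "'v pair_pre_digraph \<Rightarrow> 'v \<Rightarrow> 'v set" where
  "neighbours G v = {w. (v, w) \<in> parcs G}"


subsection \<open>Tree-decompositions\<close>

text \<open>
  The constant \<^const>\<open>tree\<close> of Graph_Theory counts a pair of opposite arcs as a cycle of length 2 and
  hence does not describe undirected trees. A cycle of a simple undirected graph is a
  \<^const>\<open>pre_digraph.cycle\<close> of length at least 3.
\<close>

definition undirected_tree :: "'t pair_pre_digraph \<Rightarrow> bool" where
  "undirected_tree T \<longleftrightarrow>
     pair_graph T \<and> Digraph_Component.connected (with_proj T) \<and>
     \<not> (\<exists>p. pre_digraph.cycle (with_proj T) p \<and> 3 \<le> length p)"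

definition tree_decomposition ::
    "'v pair_pre_digraph \<Rightarrow> 't pair_pre_digraph \<Rightarrow> ('t \<Rightarrow> 'v set) \<Rightarrow> bool" where
  "tree_decomposition G T X \<longleftrightarrow>
     undirected_tree T \<and>
     (\<forall>t\<in>pverts T. X t \<subseteq> pverts G) \<and>
     (\<Union>t\<in>pverts T. X t) = pverts G \<and>
     (\<forall>(u, v)\<in>parcs G. \<exists>t\<in>pverts T. u \<in> X t \<and> v \<in> X t) \<and>
     (\<forall>v\<in>pverts G. Digraph_Component.connected (with_proj T \<restriction> {t \<in> pverts T. v \<in> X t}))"

text \<open>The adhesion is 0 when the tree has no edge.\<close>

definition adhesion :: "'t pair_pre_digraph \<Rightarrow> ('t \<Rightarrow> 'v set) \<Rightarrow> nat" where
  "adhesion T X = Max (insert 0 {card (X t \<inter> X t') | t t'. (t, t') \<in> parcs T})"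

text \<open>
  \<open>H\<close> is obtained from \<open>G[X t]\<close> by adding, for each neighbour \<open>t'\<close> of \<open>t\<close>, a (possibly empty) set
  \<open>S t'\<close> of new vertices. Since \<^const>\<open>neighbours\<close> is taken in \<open>H\<close>, the new vertices are pairwise
  non-adjacent.
\<close>

definition bag_extension ::
    "'v pair_pre_digraph \<Rightarrow> 't pair_pre_digraph \<Rightarrow> ('t \<Rightarrow> 'v set) \<Rightarrow> 't \<Rightarrow>
     'v pair_pre_digraph \<Rightarrow> bool" where
  "bag_extension G T X t H \<longleftrightarrow>
     pair_graph H \<and>
     induced_subgraph (with_proj G \<restriction> X t) (with_proj H) \<and>
     (\<exists>S. disjoint_family_on S (neighbours T t) \<and>
          pverts H = X t \<union> (\<Union>t'\<in>neighbours T t. S t') \<and>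
          (\<forall>t'\<in>neighbours T t. S t' \<inter> X t = {} \<and>
             (\<forall>v\<in>S t'. neighbours H v \<subseteq> X t \<inter> X t')))"


subsection \<open>Asymptotic dimension\<close>

text \<open>
  Metrics take values in \<^typ>\<open>ereal\<close>: vertices in different components of a graph are at distance
  \<open>\<infinity>\<close>. The diameter of a set is measured in the ambient space.
\<close>

definition graph_dist :: "'v pair_pre_digraph \<Rightarrow> 'v \<Rightarrow> 'v \<Rightarrow> ereal" where
  "graph_dist G u v = wf_digraph.\<mu> (with_proj G) (\<lambda>_. 1) u v"

definition ediameter :: "('a \<Rightarrow> 'a \<Rightarrow> ereal) \<Rightarrow> 'a set \<Rightarrow> ereal" where
  "ediameter d A = (SUP x\<in>A. SUP y\<in>A. d x y)"

definition bounded_family :: "('a \<Rightarrow> 'a \<Rightarrow> ereal) \<Rightarrow> real \<Rightarrow> 'a set set \<Rightarrow> bool" where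
  "bounded_family d D \<U> \<longleftrightarrow> (\<forall>A\<in>\<U>. ediameter d A \<le> ereal D)"

definition r_disjoint :: "('a \<Rightarrow> 'a \<Rightarrow> ereal) \<Rightarrow> real \<Rightarrow> 'a set set \<Rightarrow> bool" where
  "r_disjoint d r \<U> \<longleftrightarrow>
     (\<forall>A\<in>\<U>. \<forall>B\<in>\<U>. A \<noteq> B \<longrightarrow> (\<forall>a\<in>A. \<forall>b\<in>B. ereal r < d a b))"

definition control_function ::
    "nat \<Rightarrow> 'a set \<Rightarrow> ('a \<Rightarrow> 'a \<Rightarrow> ereal) \<Rightarrow> (real \<Rightarrow> real) \<Rightarrow> bool" where
  "control_function n M d D \<longleftrightarrow>
     (\<forall>r>0. D r > 0 \<and>
        (\<exists>\<U>. (\<Union>i\<in>{1..n + 1}. \<Union>(\<U> i)) = M \<and>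
             (\<forall>i\<in>{1..n + 1}. r_disjoint d r (\<U> i) \<and> bounded_family d (D r) (\<U> i))))"

text \<open>The infimum of the empty set is \<open>\<infinity>\<close> in \<^typ>\<open>enat\<close>.\<close>

definition asdim :: "'v pair_pre_digraph set \<Rightarrow> enat" where
  "asdim \<G> = Inf {enat n | n. \<exists>D. \<forall>G\<in>\<G>. control_function n (pverts G) (graph_dist G) D}"

end

theory Submission
  imports Defs
begin

text \<open>
  Induction on the adhesion. Root the tree and cut it into regions: going down from the top of a
  region with top adhesion set \<open>Z\<close>, an edge is cut when its adhesion set is disjoint from the
  \<open>5r\<close>-neighbourhood of \<open>Z\<close>. Inside a region every adhesion set loses a vertex once this
  neighbourhood is deleted, so the induction hypothesis colours the rest of the region at a larger
  scale. The deleted neighbourhood is coloured in layers around \<open>Z\<close>: the first one copies the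
  colours of the parent region, the next two have different constant colours. Hence every
  monochromatic \<open>r\<close>-component lies in one region together with the first layers of its child
  regions. Its size is bounded since everything added to the components of the induction hypothesis
  is near the boundedly many vertices of an adhesion set. For adhesion 0 each bag is coloured
  separately: with a new vertex for every pair of an adhesion set that is close in \<open>G\<close>, a bag
  becomes a member of \<open>\<C>\<close> that carries, up to constants, the metric of \<open>G\<close> at the given scale.
\<close>

subsection \<open>Relation powers\<close>

text \<open>Deleting a ball changes the metric of a region, while the colourings of the bags are
  only known for the original metric. The induction therefore carries two relations:
  \<open>E0\<close>, the original adjacency, in which bags are colourable and all sizes are
  measured, and \<open>E\<close>, whose links lie inside bags and are \<open>E0\<close>-walks of
  length at most \<open>R\<close>. One level of the induction replaces \<open>E\<close> by the pairs
  of a region bag at distance at most \<open>M\<close>; the bags only shrink and only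
  \<open>R\<close> grows, so the bound depends on \<open>n\<close>, \<open>k\<close>,
  \<open>R\<close>, \<open>r\<close> and \<open>D\<close> but not on the graph. The scale is
  \<open>M = 5 * r * (q * q)\<close>: when vertices near an adhesion set are projected to it, a step
  of length \<open>r\<close> becomes one of length at most \<open>2 * r + r + 2 * r\<close>, and a
  chain inside one adhesion set of at most \<open>q\<close> vertices needs at most
  \<open>q * q\<close> links. The two constant layers need two distinct colours. This is where the 1
  in the maximum comes from.\<close>

lemma relpow_mono_exp:
  fixes E :: "'a rel"
  assumes "Id \<subseteq> E" "i \<le> j" shows "E ^^ i \<subseteq> E ^^ j"
  using assms(2)
proof (induction rule: dec_induct)
  case (step n)
  have "E ^^ n \<subseteq> E ^^ Suc n" using assms(1) by auto
  with step show ?case by blast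
qed simp

lemma sym_relpow:
  fixes E :: "'a rel"
  assumes "sym E" shows "sym (E ^^ j)"
proof (induction j)
  case (Suc n)
  show ?case
  proof (rule symI)
    fix x y assume "(x, y) \<in> E ^^ Suc n"
    then obtain z where "(x, z) \<in> E ^^ n" "(z, y) \<in> E" by auto
    then have "(z, x) \<in> E ^^ n" "(y, z) \<in> E" using Suc assms by (auto dest: symD)
    then show "(y, x) \<in> E ^^ Suc n" by (rule relpow_Suc_I2[rotated])
  qed
qed (simp add: sym_Id)

lemma relpow_trans:
  fixes E :: "'a rel"
  shows "(a, b) \<in> E ^^ i \<Longrightarrow> (b, c) \<in> E ^^ j \<Longrightarrow> (a, c) \<in> E ^^ (i + j)"
  by (auto simp: relpow_add)

lemma relpow_relpow_subset:
  fixes E :: "'a rel"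
  assumes "E \<subseteq> F ^^ R" shows "E ^^ j \<subseteq> F ^^ (R * j)"
proof (induction j)
  case (Suc n)
  have "E ^^ Suc n \<subseteq> F ^^ (R * n) O F ^^ R" using Suc assms by auto
  moreover have "R * Suc n = R * n + R" by simp
  ultimately show ?case by (simp only: relpow_add)
qed simp

text \<open>A chain never needs more links than the relation has pairs, and on at most
  \<open>q\<close> points there are at most \<open>q * q\<close> of them.\<close>

lemma rtrancl_subset_relpow:
  fixes E :: "'a rel"
  assumes "Id \<subseteq> E" "Q \<subseteq> E ^^ m" "Q \<subseteq> Z \<times> Z" "finite Z" "card Z \<le> q"
  shows "Q\<^sup>* \<subseteq> E ^^ (m * (q * q))"
proof -
  have fin: "finite Q" using assms(3,4) by (auto intro: finite_subset)
  have "card Q \<le> card (Z \<times> Z)" using assms by (intro card_mono) auto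
  also have "\<dots> \<le> q * q" using assms(5) by (simp add: card_cartesian_product mult_mono)
  finally have card: "card Q \<le> q * q" .
  show ?thesis
  proof
    fix x assume "x \<in> Q\<^sup>*"
    then obtain n where n: "n \<le> card Q" "x \<in> Q ^^ n"
      using rtrancl_finite_eq_relpow[OF fin] by auto
    then have "x \<in> E ^^ (m * n)" using relpow_relpow_subset[OF assms(2)] by blast
    moreover have "m * n \<le> m * (q * q)" using n(1) card by simp
    ultimately show "x \<in> E ^^ (m * (q * q))" using relpow_mono_exp[OF assms(1)] by blast
  qed
qed

text \<open>A chain is cut at its first and last link; between them it is tracked by nearby points of
  the finite set \<open>Z\<close>.\<close>

lemma rtrancl_centred_links:
  fixes E :: "'a rel"
  assumes E: "Id \<subseteq> E" "sym E" and K: "K\<^sup>* \<subseteq> E ^^ b"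
    and L: "L \<subseteq> E ^^ m" "L \<subseteq> ((E ^^ j) `` Z) \<times> ((E ^^ j) `` Z)"
    and Z: "finite Z" "card Z \<le> q"
  shows "(K \<union> L)\<^sup>* \<subseteq> E ^^ (2 * (b + j) + (2 * j + b + m) * (q * q))"
proof -
  \<comment> \<open>The radius covers both ways of linking two tracked points: across one
    \<open>L\<close>-link, \<open>j + m + j\<close>, and across a \<open>K\<close>-chain between two
    \<open>L\<close>-links, \<open>j + b + j\<close>.\<close>
  define Q where "Q = {(z, z'). z \<in> Z \<and> z' \<in> Z \<and> (z, z') \<in> E ^^ (2 * j + b + m)}"
  have symj: "(y, x) \<in> E ^^ i" if "(x, y) \<in> E ^^ i" for x y i
    using sym_relpow[OF E(2)] that by (metis symD)
  have le: "(x, y) \<in> E ^^ i'" if "(x, y) \<in> E ^^ i" "i \<le> i'" for x y i i'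
    using relpow_mono_exp[OF E(1)] that by blast
  have Qs: "Q\<^sup>* \<subseteq> E ^^ ((2 * j + b + m) * (q * q))"
    by (rule rtrancl_subset_relpow[OF E(1) _ _ Z]) (auto simp: Q_def)
  have inv: "(x, y) \<in> K\<^sup>* \<or> (\<exists>z z' w. z \<in> Z \<and> z' \<in> Z \<and> (x, z) \<in> E ^^ (b + j) \<and> (z, z') \<in> Q\<^sup>* \<and>
      (z', w) \<in> E ^^ j \<and> (w, y) \<in> K\<^sup>*)"
    if "(x, y) \<in> (K \<union> L)\<^sup>*" for x y
    using that
  proof (induction rule: rtrancl_induct)
    case base then show ?case by simp
  next
    case (step y y')
    show ?case
    proof (cases "(y, y') \<in> K")
      case True
      then have "(w, y') \<in> K\<^sup>*" if "(w, y) \<in> K\<^sup>*" for w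
        using that by (rule rtrancl_into_rtrancl[rotated])
      then show ?thesis using step.IH by blast
    next
      case False
      then have l: "(y, y') \<in> L" using step by auto
      obtain a a' where a: "a \<in> Z" "(a, y) \<in> E ^^ j" "a' \<in> Z" "(a', y') \<in> E ^^ j"
        using l L(2) by auto
      have aa: "(a, a') \<in> E ^^ (j + m + j)"
        using relpow_trans[OF relpow_trans[OF a(2) subsetD[OF L(1) l]] symj[OF a(4)]] .
      then have aQ: "(a, a') \<in> Q" unfolding Q_def using a le[OF aa] by auto
      from step.IH show ?thesis
      proof
        assume "(x, y) \<in> K\<^sup>*"
        then have "(x, a) \<in> E ^^ (b + j)" using relpow_trans[OF subsetD[OF K] symj[OF a(2)]] by simp
        then show ?thesis using a aQ by blast
      next
        assume "\<exists>z z' w. z \<in> Z \<and> z' \<in> Z \<and> (x, z) \<in> E ^^ (b + j) \<and> (z, z') \<in> Q\<^sup>* \<and>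
          (z', w) \<in> E ^^ j \<and> (w, y) \<in> K\<^sup>*"
        then obtain z z' w where z: "z \<in> Z" "z' \<in> Z" "(x, z) \<in> E ^^ (b + j)" "(z, z') \<in> Q\<^sup>*"
          "(z', w) \<in> E ^^ j" "(w, y) \<in> K\<^sup>*" by blast
        have "(z', a) \<in> E ^^ (j + b + j)"
          using relpow_trans[OF relpow_trans[OF z(5) subsetD[OF K z(6)]] symj[OF a(2)]] .
        then have "(z', a) \<in> Q" unfolding Q_def using z a le by auto
        then have "(z, a') \<in> Q\<^sup>*" using z(4) aQ by (meson rtrancl_into_rtrancl)
        then show ?thesis using z a by blast
      qed
    qed
  qed
  show ?thesis
  proof (clarify)
    fix x y assume "(x, y) \<in> (K \<union> L)\<^sup>*"
    from inv[OF this] show "(x, y) \<in> E ^^ (2 * (b + j) + (2 * j + b + m) * (q * q))"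
    proof
      assume "(x, y) \<in> K\<^sup>*"
      then show ?thesis using K le[of x y b] by auto
    next
      assume "\<exists>z z' w. z \<in> Z \<and> z' \<in> Z \<and> (x, z) \<in> E ^^ (b + j) \<and> (z, z') \<in> Q\<^sup>* \<and>
          (z', w) \<in> E ^^ j \<and> (w, y) \<in> K\<^sup>*"
      then obtain z z' w where z: "(x, z) \<in> E ^^ (b + j)" "(z, z') \<in> Q\<^sup>*"
          "(z', w) \<in> E ^^ j" "(w, y) \<in> K\<^sup>*" by blast
      have "(x, y) \<in> E ^^ ((b + j) + (2 * j + b + m) * (q * q) + (j + b))"
        using relpow_trans[OF relpow_trans[OF z(1) subsetD[OF Qs z(2)]]
            relpow_trans[OF z(3) subsetD[OF K z(4)]]] .
      then show ?thesis by (simp add: algebra_simps)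
    qed
  qed
qed

subsection \<open>Regions of a rooted tree-decomposition\<close>

text \<open>A tree-decomposition is encoded by a parent function \<open>p\<close>, a depth \<open>m\<close> and the topmost bag
  \<open>\<tau> v\<close> of each vertex; \<open>p a\<close> is the parent of \<open>a\<close> only where \<open>m (p a) < m a\<close>.\<close>

locale rooted_bags =
  fixes X :: "'t \<Rightarrow> 'v set" and p :: "'t \<Rightarrow> 't" and m :: "'t \<Rightarrow> nat" and \<tau> :: "'v \<Rightarrow> 't"
  assumes up: "v \<in> X a \<Longrightarrow> a \<noteq> \<tau> v \<Longrightarrow> m (p a) < m a \<and> v \<in> X (p a)"
begin

definition adh :: "'t \<Rightarrow> 'v set" where
  "adh a = (if m (p a) < m a then X a \<inter> X (p a) else {})"

text \<open>\<open>brk a s\<close> decides whether the edge above \<open>a\<close> is cut, given the top \<open>s\<close> of the region of its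
  parent; \<open>rtop brk a\<close> is the top of the region of \<open>a\<close> after removing the cut edges.\<close>

function rtop :: "('t \<Rightarrow> 't \<Rightarrow> bool) \<Rightarrow> 't \<Rightarrow> 't" where
  "rtop brk a = (if m (p a) < m a then if brk a (rtop brk (p a)) then a else rtop brk (p a) else a)"
  by auto
termination by (relation "measure (\<lambda>(brk, a). m a)") auto

declare rtop.simps[simp del]

lemma rtop_eq_self_or: "rtop brk a = a \<or> m (p a) < m a \<and> rtop brk a = rtop brk (p a)"
  using rtop.simps[of brk a] by metis

lemma rtop_le: "m (rtop brk a) \<le> m a"
proof (induction "m a" arbitrary: a rule: less_induct)
  case less
  then show ?case using rtop_eq_self_or[of brk a] by (metis le_refl less_imp_le order.trans)
qed

lemma rtop_rtop [simp]: "rtop brk (rtop brk a) = rtop brk a"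
proof (induction "m a" arbitrary: a rule: less_induct)
  case less
  then show ?case using rtop_eq_self_or[of brk a] by metis
qed

text \<open>If the edge above \<open>s\<close> were uncut, \<open>s\<close> would be the top of its
  parent, but a top is never deeper than the bag it belongs to.\<close>

lemma brk_rtop:
  assumes "rtop brk s = s" "m (p s) < m s"
  shows "brk s (rtop brk (p s))"
proof (rule ccontr)
  assume "\<not> ?thesis"
  then have "rtop brk s = rtop brk (p s)" using assms(2) by (subst rtop.simps) auto
  then show False using rtop_le[of brk "p s"] assms by simp
qed

text \<open>Climb from \<open>b\<close> towards \<open>\<tau> v\<close>: every bag on the way
  contains \<open>v\<close>, so the climb either ends inside the region or crosses the edge above
  its top and puts \<open>v\<close> into that adhesion set.\<close>

lemma home_or_adh: "v \<in> X b \<Longrightarrow> rtop brk (\<tau> v) = rtop brk b \<or> v \<in> adh (rtop brk b)"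
proof (induction "m b" arbitrary: b rule: less_induct)
  case less
  show ?case
  proof (cases "b = \<tau> v")
    case False
    then have b: "m (p b) < m b" "v \<in> X (p b)" using up less.prems by blast+
    show ?thesis
    proof (cases "rtop brk b = b")
      case True then show ?thesis using b less.prems by (simp add: adh_def)
    next
      case False
      then have "rtop brk b = rtop brk (p b)" using rtop_eq_self_or by metis
      then show ?thesis using less.hyps[OF b] by simp
    qed
  qed simp
qed

end

section \<open>The cut rule and walks between regions\<close>

locale region_step = rooted_bags X p m \<tau>
  for X :: "'t \<Rightarrow> 'v set" and p m \<tau> +
  fixes E :: "'v rel" and r :: nat
  assumes refl_E: "Id \<subseteq> E" and sym_E: "sym E" and r_pos: "0 < r"
    and E_bag: "(x, y) \<in> E \<Longrightarrow> x \<noteq> y \<Longrightarrow> \<exists>a. x \<in> X a \<and> y \<in> X a"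
begin

definition near :: "nat \<Rightarrow> 't \<Rightarrow> 'v set" where
  "near j s = (E ^^ j) `` adh s"

text \<open>If \<open>adh s\<close> is empty, as at the root, every edge below \<open>s\<close> is
  cut and the region of \<open>s\<close> is the single bag \<open>s\<close>.\<close>

definition region :: "'t \<Rightarrow> 't" where
  "region = rtop (\<lambda>a s. adh a \<inter> near (5 * r) s = {})"

definition par :: "'t \<Rightarrow> 't" where
  "par s = region (p s)"

definition home :: "'v \<Rightarrow> 't" where
  "home v = region (\<tau> v)"

lemma dist_sym: "(x, y) \<in> E ^^ j \<Longrightarrow> (y, x) \<in> E ^^ j"
  using sym_relpow[OF sym_E] by (rule symD)

lemma dist_mono: "(x, y) \<in> E ^^ i \<Longrightarrow> i \<le> j \<Longrightarrow> (x, y) \<in> E ^^ j"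
  using relpow_mono_exp[OF refl_E] by blast

lemma nearE:
  assumes "v \<in> near j s" obtains z where "z \<in> adh s" "(z, v) \<in> E ^^ j"
  using assms by (auto simp: near_def)

lemma nearI: "z \<in> adh s \<Longrightarrow> (z, v) \<in> E ^^ j \<Longrightarrow> v \<in> near j s"
  by (auto simp: near_def)

lemma near_mono: "v \<in> near i s \<Longrightarrow> i \<le> j \<Longrightarrow> v \<in> near j s"
  by (auto simp: near_def intro: dist_mono)

lemma near_walk: "v \<in> near i s \<Longrightarrow> (v, w) \<in> E ^^ j \<Longrightarrow> w \<in> near (i + j) s"
  by (auto simp: near_def intro: relpow_trans)

lemma near_step: "v \<in> near j s \<Longrightarrow> (v, w) \<in> E \<Longrightarrow> w \<in> near (Suc j) s"
  using near_walk[of v j s w 1] by simp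

lemma adh_near: "z \<in> adh s \<Longrightarrow> z \<in> near j s"
  using near_mono[of z 0 s j] by (auto simp: near_def)

lemma region_region [simp]: "region (region a) = region a"
  by (simp add: region_def)

lemma region_home [simp]: "region (home v) = home v"
  by (simp add: home_def)

lemma adh_parent: "z \<in> adh s \<Longrightarrow> m (p s) < m s \<and> z \<in> X s \<and> z \<in> X (p s)"
  by (auto simp: adh_def split: if_splits)

lemma adh_separated:
  assumes "region s = s" "z \<in> adh s" "j \<le> 5 * r" shows "z \<notin> near j (par s)"
proof -
  have "adh s \<inter> near (5 * r) (par s) = {}"
    using brk_rtop[of "\<lambda>a s. adh a \<inter> near (5 * r) s = {}" s] adh_parent[OF assms(2)] assms(1)
    by (simp add: region_def par_def)
  then show ?thesis using assms(2,3) near_mono by blast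
qed

lemma home_cases: "v \<in> X a \<Longrightarrow> home v = region a \<or> v \<in> adh (region a)"
  unfolding home_def region_def by (rule home_or_adh)

text \<open>The adhesion set of a top lies in the bag above it, and it is disjoint from the adhesion
  set of the parent region because consecutive cut edges are separated.\<close>

lemma home_adh:
  assumes "region s = s" "z \<in> adh s" shows "home z = par s"
proof -
  have "home z = par s \<or> z \<in> adh (par s)"
    using home_cases[of z "p s"] adh_parent[OF assms(2)] by (simp add: par_def)
  then show ?thesis using adh_separated[OF assms] adh_near by blast
qed

text \<open>Both ends share a bag, and each of them lives in the region of that bag or in the
  adhesion set of its top, whose vertices live one region higher.\<close>

lemma edge_cases [consumes 1, case_names same up down]:
  assumes "(x, y) \<in> E"
  obtains "home x = home y"
  | "y \<in> adh (home x)" "home y = par (home x)"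
  | "x \<in> adh (home y)" "home x = par (home y)"
proof (cases "x = y")
  case False
  then obtain a where a: "x \<in> X a" "y \<in> X a" using E_bag assms by blast
  have r: "region (region a) = region a" by simp
  show ?thesis using home_cases[OF a(1)] home_cases[OF a(2)] home_adh[OF r] that by metis
qed (use that in blast)

text \<open>A walk of length at most \<open>r\<close> cannot meet the adhesion sets of two consecutive cut edges, so
  it stays within one region and its children.\<close>

lemma short_walk:
  assumes "(u, w) \<in> E ^^ j" "j \<le> r"
  shows "home w = home u
    \<or> u \<in> near j (home u) \<and>
        (home w = par (home u) \<or> par (home w) = par (home u) \<and> w \<in> near j (home w))
    \<or> par (home w) = home u \<and> w \<in> near j (home w)"
  using assms
proof (induction j arbitrary: w)
  case 0 then show ?case by simp
next
  case (Suc j)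
  then obtain w' where w': "(u, w') \<in> E ^^ j" "(w', w) \<in> E" by auto
  have n: "v \<in> near (Suc j) s" if "v \<in> near j s" for v s using near_mono[OF that] by simp
  consider "home w' = home u"
    | "u \<in> near j (home u)" "home w' = par (home u)"
    | "u \<in> near j (home u)" "par (home w') = par (home u)" "w' \<in> near j (home w')"
    | "par (home w') = home u" "w' \<in> near j (home w')"
    using Suc.IH[OF w'(1)] Suc.prems by fastforce
  note IH = this
  from w'(2) show ?case
  proof (cases rule: edge_cases)
    case same
    then show ?thesis using IH n near_step[OF _ w'(2)] by metis
  next
    case up
    have u: "w \<in> adh (home w')" "home w = par (home w')" using up by auto
    have un: "u \<in> near (Suc j) (home w')"
      using nearI[OF u(1) dist_sym, of u "Suc j"] Suc.prems by blast
    show ?thesis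
    proof (cases rule: IH)
      case 1 then show ?thesis using u un by metis
    next
      case 2
      \<comment> \<open>A second climb: \<open>adh (home u)\<close> and the adhesion set above its
        parent region would be at distance at most \<open>Suc j + j\<close>, within the separation
        \<open>5 * r\<close>.\<close>
      obtain z where z: "z \<in> adh (home u)" "(z, u) \<in> E ^^ j" using 2 by (auto elim: nearE)
      have "z \<in> near (Suc j + j) (par (home u))"
        using near_walk[OF un dist_sym[OF z(2)]] 2 by simp
      moreover have "z \<notin> near (Suc j + j) (par (home u))"
        using adh_separated[OF _ z(1)] Suc.prems r_pos by simp
      ultimately show ?thesis by blast
    next
      case 3 then show ?thesis using u n by metis
    next
      case 4 then show ?thesis using u by metis
    qed
  next
    case down
    have d: "w' \<in> adh (home w)" "home w' = par (home w)" using down by auto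
    have wn: "w \<in> near (Suc j) (home w)"
      using near_mono[OF near_step[OF adh_near[OF d(1), of 0] w'(2)]] by simp
    \<comment> \<open>A second descent is excluded: \<open>w'\<close> would be within
      \<open>j\<close> of \<open>adh (home w')\<close> while lying in the adhesion set of the next
      cut edge.\<close>
    have sep: "w' \<notin> near j (home w')"
      using adh_separated[OF _ d(1), of j] d(2) Suc.prems by simp
    show ?thesis
    proof (cases rule: IH)
      case 1 then show ?thesis using d wn by metis
    next
      case 2 then show ?thesis using d wn n by metis
    next
      case 3 then show ?thesis using sep by simp
    next
      case 4 then show ?thesis using sep by simp
    qed
  qed
qed

definition Par :: "'t rel" where
  "Par = {(s, par s) | s. region s = s \<and> m (p s) < m s}"

definition below :: "'t \<Rightarrow> 'v \<Rightarrow> bool" where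
  "below t w \<longleftrightarrow> (home w, t) \<in> Par\<^sup>*"

lemma Par_home: "z \<in> adh (home v) \<Longrightarrow> (home v, par (home v)) \<in> Par"
  using adh_parent by (auto simp: Par_def)

text \<open>An edge changes the region by at most one level, so the only way out of the subtree of
  \<open>t\<close> is one step up from \<open>t\<close> itself.\<close>

lemma below_exit:
  assumes "(x, y) \<in> E" "below t x" "\<not> below t y"
  shows "y \<in> adh t \<and> home y = par t"
  using assms(1)
proof (cases rule: edge_cases)
  case same then show ?thesis using assms by (simp add: below_def)
next
  case up
  from assms(2) have "(home x, t) \<in> Par\<^sup>*" by (simp add: below_def)
  then show ?thesis
  proof (cases rule: converse_rtranclE)
    case (step s)
    then have "s = home y" using up by (auto simp: Par_def)
    then show ?thesis using step assms(3) by (simp add: below_def)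
  qed (use up in simp)
next
  case down
  then have "below t y" using Par_home[of x y] assms(2)
    by (metis below_def converse_rtrancl_into_rtrancl)
  then show ?thesis using assms(3) by simp
qed

text \<open>Tops get strictly less deep towards the root, so no region lies below its own
  child.\<close>

lemma not_below_child:
  assumes "z \<in> adh t" "par t = home v" shows "\<not> below t v"
proof
  have le: "m (par s) \<le> m (p s)" for s using rtop_le by (simp add: par_def region_def)
  assume "below t v"
  then have "(home v, t) \<in> Par\<^sup>*" by (simp add: below_def)
  then have "m t \<le> m (home v)"
  proof (induction rule: rtrancl_induct)
    case (step s s')
    then show ?case using le[of s] by (auto simp: Par_def)
  qed simp
  then show False using le[of t] adh_parent[OF assms(1)] assms(2) by simp
qed

section \<open>Regions with the ball around the top adhesion set removed\<close>

definition region_bag :: "'t \<Rightarrow> 't \<Rightarrow> 'v set" where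
  "region_bag s a = (if region a = s then X a - near (5 * r) s else {})"

text \<open>The only vertices that continue upwards out of the region are those of
  \<open>adh s\<close>, and they are deleted; hence the old \<open>\<tau>\<close> still
  serves.\<close>

lemma rooted_region_bag: "rooted_bags (region_bag s) p m \<tau>"
proof
  fix v a assume v: "v \<in> region_bag s a" and ne: "a \<noteq> \<tau> v"
  then have s: "region a = s" "v \<in> X a" "v \<notin> near (5 * r) s"
    by (auto simp: region_bag_def split: if_splits)
  have u: "m (p a) < m a" "v \<in> X (p a)" using up[OF s(2) ne] by auto
  have "region (p a) = s"
  proof (rule ccontr)
    assume "region (p a) \<noteq> s"
    then have "region a = a" using s(1) rtop_eq_self_or unfolding region_def by metis
    then have "v \<in> adh s" using u s by (auto simp: adh_def)
    then show False using s(3) adh_near by blast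
  qed
  then show "m (p a) < m a \<and> v \<in> region_bag s (p a)" using u s by (simp add: region_bag_def)
qed

text \<open>An uncut edge has an adhesion vertex near \<open>adh s\<close>, and this vertex is deleted: the induction
  on the adhesion rests on this.\<close>

lemma card_adh_region_bag:
  assumes "finite (adh a)" "card (adh a) \<le> Suc k"
  shows "finite (rooted_bags.adh (region_bag s) p m a) \<and>
    card (rooted_bags.adh (region_bag s) p m a) \<le> k"
proof -
  let ?A = "rooted_bags.adh (region_bag s) p m a"
  note A_def = rooted_bags.adh_def[OF rooted_region_bag, of s a]
  have sub: "?A \<subseteq> adh a - near (5 * r) s"
    unfolding A_def adh_def by (auto simp: region_bag_def split: if_splits)
  show ?thesis
  proof (cases "?A = {}")
    case False
    then have a: "m (p a) < m a" "region a = s" "region (p a) = s"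
      unfolding A_def by (auto simp: region_bag_def split: if_splits)
    have "adh a \<inter> near (5 * r) s \<noteq> {}"
    proof
      assume e: "adh a \<inter> near (5 * r) s = {}"
      then have "region a = a"
        using a rtop.simps[of "\<lambda>a s. adh a \<inter> near (5 * r) s = {}" a] by (simp add: region_def)
      then show False using a rtop_le[of "\<lambda>a s. adh a \<inter> near (5 * r) s = {}" "p a"]
        by (simp add: region_def)
    qed
    then have "?A \<subset> adh a" using sub by auto
    then have "card ?A < card (adh a)" "finite ?A"
      using assms(1) by (auto intro: psubset_card_mono finite_subset)
    then show ?thesis using assms(2) by simp
  qed simp
qed

text \<open>Keeping all short distances within bags makes up for the walks that leave the region
  through a cut edge.\<close>

definition inner :: "nat \<Rightarrow> 't \<Rightarrow> 'v rel" where
  "inner M s = Id \<union> {(u, v). (\<exists>a. u \<in> region_bag s a \<and> v \<in> region_bag s a) \<and> (u, v) \<in> E ^^ M}"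

lemma refl_inner: "Id \<subseteq> inner M s"
  by (auto simp: inner_def)

lemma sym_inner: "sym (inner M s)"
  by (auto simp: inner_def sym_def dest: dist_sym)

lemma inner_subset: "inner M s \<subseteq> E ^^ M"
  using relpow_mono_exp[OF refl_E, of 0 M] by (auto simp: inner_def)

text \<open>The adhesion set of a child region lies in the bag above its top, which belongs to
  region \<open>s\<close>, and the cut rule keeps it out of the deleted ball.\<close>

lemma adh_inner:
  assumes "region t = t" "par t = s" "x \<in> adh t" "y \<in> adh t" "(x, y) \<in> E ^^ j" "j \<le> M"
  shows "(x, y) \<in> inner M s"
proof -
  have "region (p t) = s" using assms(2) by (simp add: par_def)
  moreover have "x \<notin> near (5 * r) s" "y \<notin> near (5 * r) s" using adh_separated assms(1-4) by blast+
  moreover have "x \<in> X (p t)" "y \<in> X (p t)" using adh_parent assms(3,4) by blast+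
  ultimately have "x \<in> region_bag s (p t) \<and> y \<in> region_bag s (p t)"
    by (simp add: region_bag_def)
  then show ?thesis using dist_mono[OF assms(5,6)] by (auto simp: inner_def)
qed

lemma edge_inner:
  assumes "home x = s" "home y = s" "(x, y) \<in> E" "0 < M"
    "x \<notin> near (5 * r) s" "y \<notin> near (5 * r) s"
  shows "(x, y) \<in> inner M s"
proof (cases "x = y")
  case False
  then obtain a where a: "x \<in> X a" "y \<in> X a" using E_bag assms by blast
  have e: "(x, y) \<in> E ^^ 1" using assms(3) by simp
  show ?thesis
  proof (cases "region a = s")
    case True
    then have "x \<in> region_bag s a \<and> y \<in> region_bag s a" using a assms by (simp add: region_bag_def)
    then show ?thesis using dist_mono[OF e] assms(4) by (auto simp: inner_def)
  next
    case False
    then have *: "x \<in> adh (region a)" "y \<in> adh (region a)" using home_cases a assms(1,2) by metis+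
    moreover have "par (region a) = s" using home_adh[OF _ *(1)] assms(1) by simp
    ultimately show ?thesis using adh_inner[OF region_region _ _ _ e] assms(4) by simp
  qed
qed (simp add: inner_def)

text \<open>Started outside the larger ball, a walk of length \<open>M\<close> never meets the
  deleted one. Each excursion into a child region enters and leaves through one adhesion set, at
  distance at most \<open>M\<close>, and is replaced by a single \<open>inner\<close> link.\<close>

lemma inner_walk:
  assumes "home u = s" "u \<notin> near (5 * r + M) s" "home v = s" "(u, v) \<in> E ^^ M" "0 < M"
  shows "(u, v) \<in> inner M s ^^ M"
proof -
  have far: "w \<notin> near (5 * r) s" if "(u, w) \<in> E ^^ j" "j \<le> M" for w j
  proof
    assume "w \<in> near (5 * r) s"
    then have "u \<in> near (5 * r + M) s" using near_walk dist_sym[OF dist_mono[OF that]] by simp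
    then show False using assms(2) by simp
  qed
  have imono: "(x, y) \<in> inner M s ^^ j" if "(x, y) \<in> inner M s ^^ i" "i \<le> j" for x y i j
    using relpow_mono_exp[OF refl_inner] that by blast
  \<comment> \<open>Either the walk is at home in \<open>s\<close> and copied so far, or it is below
    a child \<open>t\<close> entered from \<open>z\<close>, and \<open>j - i\<close> is the length
    of the current excursion.\<close>
  have "home w = s \<and> (u, w) \<in> inner M s ^^ j \<or>
      (\<exists>t z i. i \<le> j \<and> region t = t \<and> par t = s \<and> z \<in> adh t \<and> (u, z) \<in> inner M s ^^ i \<and>
        (z, w) \<in> E ^^ (j - i) \<and> below t w)"
    if "(u, w) \<in> E ^^ j" "j \<le> M" for w j
    using that
  proof (induction j arbitrary: w)
    case 0 then show ?case using assms(1) by simp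
  next
    case (Suc j)
    then obtain w' where w': "(u, w') \<in> E ^^ j" "(w', w) \<in> E" by auto
    note fw = far[OF Suc.prems]
    have fw': "w' \<notin> near (5 * r) s" using far[OF w'(1)] Suc.prems by simp
    have "j \<le> M" using Suc.prems by simp
    from Suc.IH[OF w'(1) this] show ?case
    proof
      assume A: "home w' = s \<and> (u, w') \<in> inner M s ^^ j"
      from w'(2) show ?thesis
      proof (cases rule: edge_cases)
        case same
        then have hw: "home w' = s" "home w = s" using A by auto
        then have "(w', w) \<in> inner M s" by (rule edge_inner[OF _ _ w'(2) assms(5) fw' fw])
        then have "(u, w) \<in> inner M s ^^ Suc j" using A by (intro relpow_Suc_I) auto
        then show ?thesis using hw by simp
      next
        case up
        then show ?thesis using A fw adh_near by blast
      next
        case down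
        have "below (home w) w" by (simp add: below_def)
        moreover have "(w', w) \<in> E ^^ (Suc j - j)" using w' by simp
        ultimately show ?thesis using down A le_SucI[OF le_refl, of j] region_home by metis
      qed
    next
      assume "\<exists>t z i. i \<le> j \<and> region t = t \<and> par t = s \<and> z \<in> adh t \<and> (u, z) \<in> inner M s ^^ i \<and>
        (z, w') \<in> E ^^ (j - i) \<and> below t w'"
      then obtain t z i where t: "i \<le> j" "region t = t" "par t = s" "z \<in> adh t"
        "(u, z) \<in> inner M s ^^ i" "(z, w') \<in> E ^^ (j - i)" "below t w'" by blast
      have "(z, w) \<in> E ^^ Suc (j - i)" using t(6) w'(2) by auto
      then have zw: "(z, w) \<in> E ^^ (Suc j - i)" using t(1) by (simp add: Suc_diff_le)
      show ?thesis
      proof (cases "below t w")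
        case True
        then show ?thesis using t zw le_SucI by metis
      next
        case False
        then have w: "w \<in> adh t" "home w = s" using below_exit[OF w'(2) t(7)] t(3) by auto
        have "(z, w) \<in> inner M s"
          by (rule adh_inner[OF t(2,3,4) w(1) zw]) (use Suc.prems in simp)
        then have "(u, w) \<in> inner M s ^^ Suc i" using t(5) by (intro relpow_Suc_I)
        then show ?thesis using imono[of u w "Suc i" "Suc j"] t(1) w by simp
      qed
    qed
  qed
  \<comment> \<open>At \<open>v\<close> no excursion can be pending: the home of \<open>v\<close> is
    the parent of \<open>t\<close>, hence not below \<open>t\<close>.\<close>
  from this[OF assms(4) le_refl] show ?thesis
    using not_below_child[of _ _ v, unfolded assms(3)] by blast
qed

end

subsection \<open>Gluing the colourings of the regions\<close>

locale region_colouring = region_step X p m \<tau> E r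
  for X :: "'t \<Rightarrow> 'v set" and p m \<tau> E r +
  fixes c :: "'t \<Rightarrow> 'v \<Rightarrow> nat" and E0 :: "'v rel" and R b q M :: nat
  assumes refl_E0: "Id \<subseteq> E0" and sym_E0: "sym E0" and E_E0: "E \<subseteq> E0 ^^ R"
    and fin_adh: "finite (adh a)" and card_adh: "card (adh a) \<le> q" and q_pos: "0 < q"
    and M_eq: "M = 5 * r * (q * q)"
    and inner_bounded: "{(u, v). c s u = c s v \<and> (u, v) \<in> inner M s ^^ M}\<^sup>* \<subseteq> E0 ^^ b"
begin

text \<open>Vertices within \<open>2 * r\<close> of their top adhesion set are moved onto it, hence
  into the parent region; \<open>centre\<close> names the region whose chains they then
  join.\<close>

definition prj :: "'v \<Rightarrow> 'v" where
  "prj v = (if v \<in> near (2 * r) (home v)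
    then SOME z. z \<in> adh (home v) \<and> (z, v) \<in> E ^^ (2 * r) else v)"

definition centre :: "'v \<Rightarrow> 't" where
  "centre v = (if v \<in> near (2 * r) (home v) then par (home v) else home v)"

definition hidden :: "'v \<Rightarrow> bool" where
  "hidden v \<longleftrightarrow> v \<in> near (2 * r) (home v) \<and> v \<notin> near r (home v)"

text \<open>No monochromatic chain with steps of length at most \<open>r\<close> crosses both the layer of colour 0 and
  the layer of colour 1.\<close>

definition colour :: "'v \<Rightarrow> nat" where
  "colour v = (if v \<in> near r (home v) then c (par (home v)) (prj v)
    else if v \<in> near (2 * r) (home v) then 0
    else if v \<in> near (5 * r) (home v) then 1
    else c (home v) v)"

definition step :: "'v rel" where
  "step = {(u, v). colour u = colour v \<and> (u, v) \<in> E ^^ r}"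

lemma M_ge: "5 * r \<le> M" "0 < M"
  using q_pos r_pos by (auto simp: M_eq)

lemma sym_step: "(u, v) \<in> step \<Longrightarrow> (v, u) \<in> step"
  by (auto simp: step_def dest: dist_sym)

lemma prj_near:
  assumes "v \<in> near (2 * r) (home v)"
  shows "prj v \<in> adh (home v)" "(prj v, v) \<in> E ^^ (2 * r)"
proof -
  have "\<exists>z. z \<in> adh (home v) \<and> (z, v) \<in> E ^^ (2 * r)" using assms by (auto elim: nearE)
  from someI_ex[OF this] show "prj v \<in> adh (home v)" "(prj v, v) \<in> E ^^ (2 * r)"
    using assms by (auto simp: prj_def)
qed

lemma prj_dist: "(v, prj v) \<in> E ^^ (2 * r)"
proof (cases "v \<in> near (2 * r) (home v)")
  case True then show ?thesis using prj_near dist_sym by blast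
next
  case False then show ?thesis using dist_mono[of v v 0 "2 * r"] by (simp add: prj_def)
qed

lemma prj_step: "(u, v) \<in> step \<Longrightarrow> (prj u, prj v) \<in> E ^^ (5 * r)"
proof -
  assume "(u, v) \<in> step"
  then have "(u, v) \<in> E ^^ r" by (simp add: step_def)
  from relpow_trans[OF relpow_trans[OF dist_sym[OF prj_dist] this] prj_dist]
  show ?thesis by (rule dist_mono) simp
qed

text \<open>Within \<open>2 * r\<close> of its own top adhesion set and, through \<open>w\<close>,
  within \<open>2 * r\<close> of the one below, \<open>u\<close> would join two consecutive cut
  adhesion sets by a walk of length \<open>4 * r\<close>.\<close>

lemma down_far:
  assumes "par (home w) = home u" "w \<in> near r (home w)" "(u, w) \<in> E ^^ r"
  shows "u \<notin> near (2 * r) (home u)"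
proof
  assume u: "u \<in> near (2 * r) (home u)"
  obtain z where z: "z \<in> adh (home w)" "(z, w) \<in> E ^^ r" using assms(2) by (auto elim: nearE)
  have "z \<in> near (2 * r + (r + r)) (par (home w))"
    using near_walk[OF u relpow_trans[OF assms(3) dist_sym[OF z(2)]]] assms(1) by simp
  moreover have "z \<notin> near (2 * r + (r + r)) (par (home w))"
    using adh_separated[OF region_home z(1)] by simp
  ultimately show False by simp
qed

lemma step_cases [consumes 1, case_names same up siblings down]:
  assumes "(u, v) \<in> step"
  obtains "home v = home u"
  | "u \<in> near r (home u)" "home v = par (home u)" "v \<notin> near (2 * r) (home v)"
  | "u \<in> near r (home u)" "v \<in> near r (home v)" "par (home v) = par (home u)"
  | "v \<in> near r (home v)" "home u = par (home v)" "u \<notin> near (2 * r) (home u)"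
proof -
  have uv: "(u, v) \<in> E ^^ r" using assms by (simp add: step_def)
  show ?thesis
    using short_walk[OF uv le_refl] down_far[OF _ _ uv] down_far[OF _ _ dist_sym[OF uv]] that
    by metis
qed

lemma near_r_2r: "v \<in> near r s \<Longrightarrow> v \<in> near (2 * r) s"
  by (erule near_mono) simp

text \<open>Neither constant layer is thinner than \<open>r\<close>, so a step across the boundary
  at \<open>2 * r\<close> would lead from colour 0 to colour 1.\<close>

lemma same_home_near:
  assumes "(u, v) \<in> step" "home v = home u" "u \<in> near (2 * r) (home u)"
  shows "v \<in> near (2 * r) (home v)"
proof (rule ccontr)
  assume v: "v \<notin> near (2 * r) (home v)"
  have uv: "(u, v) \<in> E ^^ r" "colour u = colour v" using assms(1) by (auto simp: step_def)
  have "v \<in> near (2 * r + r) (home v)" using near_walk[OF assms(3) uv(1)] assms(2) by simp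
  then have "v \<in> near (5 * r) (home v)" by (rule near_mono) simp
  then have "colour v = 1" using v near_r_2r by (auto simp: colour_def)
  moreover have "u \<notin> near r (home u)"
    using near_walk[OF _ uv(1), of r "home u"] v assms(2) by (auto simp: mult_2)
  then have "colour u = 0" using assms(3) by (simp add: colour_def)
  ultimately show False using uv by simp
qed

text \<open>A step changes the home only from within \<open>r\<close> of an adhesion set, where
  \<open>centre\<close> already is the parent; inside one home the boundary at \<open>2 * r\<close>
  is never crossed. Hence a monochromatic component has a single centre.\<close>

lemma centre_step:
  assumes "(u, v) \<in> step" shows "centre u = centre v"
  using assms
proof (cases rule: step_cases)
  case same
  then have "u \<in> near (2 * r) (home u) \<longleftrightarrow> v \<in> near (2 * r) (home v)"
    using same_home_near[OF assms] same_home_near[OF sym_step[OF assms]] by metis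
  then show ?thesis using same by (simp add: centre_def)
qed (use near_r_2r in \<open>auto simp: centre_def\<close>)

lemma hidden_step:
  assumes "(u, v) \<in> step" "hidden u"
  shows "home v = home u" "v \<in> near (2 * r) (home v)"
proof -
  show h: "home v = home u"
    using assms(1) by (cases rule: step_cases) (use assms(2) in \<open>auto simp: hidden_def\<close>)
  show "v \<in> near (2 * r) (home v)"
    using same_home_near[OF assms(1) h] assms(2) by (simp add: hidden_def)
qed

lemma visible_colour:
  assumes "\<not> hidden v" "prj v \<notin> near (5 * r) (centre v)"
  shows "colour v = c (centre v) (prj v)" "home (prj v) = centre v"
proof -
  have "colour v = c (centre v) (prj v) \<and> home (prj v) = centre v"
  proof (cases "v \<in> near (2 * r) (home v)")
    case True
    then show ?thesis
      using assms(1) home_adh[OF region_home prj_near(1)[OF True]]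
      by (simp add: hidden_def colour_def centre_def)
  next
    case False
    then have "prj v = v" "centre v = home v" by (auto simp: prj_def centre_def)
    then show ?thesis using False assms(2) near_r_2r by (auto simp: colour_def)
  qed
  then show "colour v = c (centre v) (prj v)" "home (prj v) = centre v" by auto
qed

section \<open>Monochromatic chains traced by their projections\<close>

definition inner_step :: "'t \<Rightarrow> 'v rel" where
  "inner_step s = {(u, v). c s u = c s v \<and> (u, v) \<in> inner M s ^^ M}"

definition central_step :: "'t \<Rightarrow> 'v rel" where
  "central_step s = {(u, v). u \<in> near (5 * r + M) s \<and> v \<in> near (5 * r + M) s \<and> (u, v) \<in> E ^^ M}"

definition adh_step :: "'t \<Rightarrow> 'v rel" where
  "adh_step t = {(u, v). u \<in> adh t \<and> v \<in> adh t \<and> (u, v) \<in> E ^^ (5 * r)}"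

lemma adh_chain: "(adh_step t)\<^sup>* \<subseteq> E ^^ M"
  unfolding M_eq
  by (rule rtrancl_subset_relpow[OF refl_E _ _ fin_adh card_adh]) (auto simp: adh_step_def)

text \<open>If one projection is outside the ball of radius \<open>5 * r + M\<close>, both are
  outside the deleted ball, so their colours come from \<open>c s\<close> and
  \<open>inner_walk\<close> applies. Otherwise both are close to \<open>adh s\<close> and the link
  is central.\<close>

lemma visible_step:
  assumes "(u, v) \<in> step" "\<not> hidden u" "\<not> hidden v" "centre u = s"
  shows "(prj u, prj v) \<in> inner_step s \<union> central_step s"
proof -
  have d: "(prj u, prj v) \<in> E ^^ M" using dist_mono[OF prj_step[OF assms(1)] M_ge(1)] .
  have cv: "centre v = s" using centre_step[OF assms(1)] assms(4) by simp
  have far: "y \<notin> near (5 * r) s" if "x \<notin> near (5 * r + M) s" "(x, y) \<in> E ^^ M" for x y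
    using near_walk[OF _ dist_sym[OF that(2)]] that(1) by blast
  have far': "x \<notin> near (5 * r) s" if "x \<notin> near (5 * r + M) s" for x
    using near_mono[of x "5 * r" s "5 * r + M"] that by auto
  have col: "colour u = colour v" using assms(1) by (simp add: step_def)
  consider "prj u \<in> near (5 * r + M) s" "prj v \<in> near (5 * r + M) s"
    | "prj u \<notin> near (5 * r + M) s" | "prj v \<notin> near (5 * r + M) s" by blast
  then show ?thesis
  proof cases
    case 1 then show ?thesis using d by (simp add: central_step_def)
  next
    case 2
    have h: "home (prj u) = s" "home (prj v) = s" and cc: "c s (prj u) = c s (prj v)"
      using visible_colour[OF assms(2)] visible_colour[OF assms(3)] far[OF 2 d] far'[OF 2] cv
        assms(4) col by auto
    show ?thesis using inner_walk[OF h(1) 2 h(2) d M_ge(2)] cc by (simp add: inner_step_def)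
  next
    case 3
    have h: "home (prj u) = s" "home (prj v) = s" and cc: "c s (prj u) = c s (prj v)"
      using visible_colour[OF assms(2)] visible_colour[OF assms(3)] far[OF 3 dist_sym[OF d]]
        far'[OF 3] cv assms(4) col by auto
    have "(prj v, prj u) \<in> inner M s ^^ M"
      by (rule inner_walk[OF h(2) 3 h(1) dist_sym[OF d] M_ge(2)])
    then have "(prj u, prj v) \<in> inner M s ^^ M" using sym_relpow[OF sym_inner] by (metis symD)
    then show ?thesis using cc by (simp add: inner_step_def)
  qed
qed

lemma hidden_adh_step:
  assumes "(u, v) \<in> step" "hidden u"
  shows "(prj u, prj v) \<in> adh_step (home u)"
  using hidden_step[OF assms] prj_near(1)[of u] prj_near(1)[of v] prj_step[OF assms(1)] assms(2)
  by (simp add: hidden_def adh_step_def)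

lemma adh_step_sym: "(x, y) \<in> adh_step t \<Longrightarrow> (y, x) \<in> adh_step t"
  by (auto simp: adh_step_def dest: dist_sym)

text \<open>A run of hidden vertices stays below one adhesion set \<open>adh t\<close>. Its two visible ends project
  into \<open>adh t\<close>, hence into a common bag, at distance at most \<open>M\<close>, so it is one \<open>inner_step\<close>.\<close>

lemma visible_chain:
  assumes "(u, v) \<in> step\<^sup>*" "\<not> hidden u" "centre u = s"
  shows "\<exists>w. \<not> hidden w \<and> colour w = colour v \<and> centre w = s \<and> centre v = s \<and>
    (prj u, prj w) \<in> (inner_step s \<union> central_step s)\<^sup>* \<and>
    (if hidden v then w \<in> near r (home w) \<and> home w = home v \<and>
      (prj w, prj v) \<in> (adh_step (home v))\<^sup>* else w = v)"
  using assms(1)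
\<comment> \<open>\<open>w\<close> is the last visible vertex of the chain up to \<open>v\<close>; a
  pending hidden run is remembered only by its projections in one adhesion set.\<close>
proof (induction rule: rtrancl_induct)
  case base then show ?case using assms(2,3) by auto
next
  case (step v v')
  let ?K = "inner_step s \<union> central_step s"
  have col: "colour v = colour v'" using step.hyps(2) by (simp add: step_def)
  have cv: "centre v' = centre v" using centre_step[OF step.hyps(2)] by simp
  from step.IH obtain w where w: "\<not> hidden w" "colour w = colour v" "centre w = s" "centre v = s"
    "(prj u, prj w) \<in> ?K\<^sup>*"
    and wv: "if hidden v then w \<in> near r (home w) \<and> home w = home v \<and>
      (prj w, prj v) \<in> (adh_step (home v))\<^sup>* else w = v" by blast
  show ?case
  proof (cases "hidden v")
    case hv: True
    then have wv: "w \<in> near r (home w)" "home w = home v" "(prj w, prj v) \<in> (adh_step (home v))\<^sup>*"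
      using wv by auto
    note h = hidden_step[OF step.hyps(2) hv]
    have ch: "(prj w, prj v') \<in> (adh_step (home v))\<^sup>*"
      using rtrancl_into_rtrancl[OF wv(3) hidden_adh_step[OF step.hyps(2) hv]] .
    show ?thesis
    proof (cases "hidden v'")
      case True
      then show ?thesis using w wv h ch col cv by (intro exI[of _ w]) simp
    next
      case False
      have w2: "w \<in> near (2 * r) (home w)" using wv(1) near_r_2r by blast
      have t: "par (home v) = s" using w(3) w2 wv(2) by (simp add: centre_def)
      have v'r: "v' \<in> near r (home v')" using False h(2) by (simp add: hidden_def)
      have pw: "prj w \<in> adh (home v)" "prj v' \<in> adh (home v)"
        using prj_near(1)[OF w2] prj_near(1)[OF h(2)] wv(2) h(1) by auto
      have d: "(prj w, prj v') \<in> E ^^ M" using ch adh_chain by blast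
      have "(prj w, prj v') \<in> inner M s" by (rule adh_inner[OF region_home t pw d]) simp
      then have "(prj w, prj v') \<in> inner M s ^^ M"
        using relpow_mono_exp[OF refl_inner, of 1 M] M_ge(2) by auto
      moreover have "c s (prj w) = c s (prj v')"
        using wv(1,2) t v'r h(1) w(2) col by (simp add: colour_def)
      ultimately have "(prj w, prj v') \<in> ?K" by (simp add: inner_step_def)
      then have "(prj u, prj v') \<in> ?K\<^sup>*" using w(5) by (rule rtrancl_into_rtrancl[rotated])
      then show ?thesis using False cv w by (intro exI[of _ v']) simp
    qed
  next
    case hv: False
    then have wv: "w = v" using wv by simp
    show ?thesis
    proof (cases "hidden v'")
      case True
      note h = hidden_step[OF sym_step[OF step.hyps(2)] True]
      have "v \<in> near r (home v)" using hv h(2) by (simp add: hidden_def)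
      moreover have "(prj v, prj v') \<in> (adh_step (home v'))\<^sup>*"
        using adh_step_sym[OF hidden_adh_step[OF sym_step[OF step.hyps(2)] True]] by blast
      ultimately show ?thesis using True w wv h col cv by (intro exI[of _ v]) simp
    next
      case False
      have "(prj v, prj v') \<in> ?K" by (rule visible_step[OF step.hyps(2) hv False w(4)])
      then have "(prj u, prj v') \<in> ?K\<^sup>*"
        using w(5) wv by (blast intro: rtrancl_into_rtrancl)
      then show ?thesis using False cv w by (intro exI[of _ v']) simp
    qed
  qed
qed

lemma hidden_chain:
  assumes "(u, v) \<in> step\<^sup>*" "\<And>w. (u, w) \<in> step\<^sup>* \<Longrightarrow> hidden w"
  shows "(prj u, prj v) \<in> (adh_step (home u))\<^sup>* \<and> home v = home u"
  using assms(1)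
proof (induction rule: rtrancl_induct)
  case (step v v')
  have h: "hidden v" using assms(2) step.hyps(1) .
  show ?case
    using rtrancl_into_rtrancl[of "prj u" "prj v"] hidden_adh_step[OF step.hyps(2) h]
      hidden_step(1)[OF step.hyps(2) h] step.IH by metis
qed simp

text \<open>The summands, in order: from the start to its projection, the visible projections by
  \<open>rtrancl_centred_links\<close>, a final hidden run, and back from the projection. The factor
  \<open>R\<close> converts \<open>E\<close> into \<open>E0\<close>.\<close>

definition bound :: nat where
  "bound = (let j = R * (5 * r + M) in
    R * (2 * r) + (2 * (b + j) + (2 * j + b + R * M) * (q * q)) + R * M + R * (2 * r))"

lemma E_dist_E0: "(x, y) \<in> E ^^ j \<Longrightarrow> (x, y) \<in> E0 ^^ (R * j)"
  using relpow_relpow_subset[OF E_E0] by blast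

lemma visible_bounded:
  assumes "(u, v) \<in> step\<^sup>*" "\<not> hidden u"
  shows "(u, v) \<in> E0 ^^ bound"
proof -
  let ?s = "centre u" and ?j = "R * (5 * r + M)"
  have 1: "(inner_step ?s)\<^sup>* \<subseteq> E0 ^^ b" using inner_bounded by (simp add: inner_step_def)
  have 2: "central_step ?s \<subseteq> E0 ^^ (R * M)" using E_dist_E0 by (auto simp: central_step_def)
  have 3: "central_step ?s \<subseteq> ((E0 ^^ ?j) `` adh ?s) \<times> ((E0 ^^ ?j) `` adh ?s)"
    using E_dist_E0 by (auto simp: central_step_def elim!: nearE)
  note C = rtrancl_centred_links[OF refl_E0 sym_E0 1 2 3 fin_adh card_adh]
  from visible_chain[OF assms refl] obtain w where
    w: "(prj u, prj w) \<in> (inner_step ?s \<union> central_step ?s)\<^sup>*"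
    and wv: "if hidden v then (prj w, prj v) \<in> (adh_step (home v))\<^sup>* else w = v" by metis
  have "(prj w, prj v) \<in> E ^^ M"
  proof (cases "hidden v")
    case True then show ?thesis using wv adh_chain by auto
  next
    case False then show ?thesis using wv dist_mono[of "prj v" "prj v" 0 M] by simp
  qed
  note E_dist_E0[OF this]
  from relpow_trans[OF relpow_trans[OF relpow_trans[OF E_dist_E0[OF prj_dist] subsetD[OF C w]]
      this] E_dist_E0[OF dist_sym[OF prj_dist]]]
  show ?thesis by (simp add: bound_def Let_def)
qed

lemma step_bounded: "step\<^sup>* \<subseteq> E0 ^^ (2 * bound)"
proof (clarify)
  fix u v assume uv: "(u, v) \<in> step\<^sup>*"
  have symE0: "(y, x) \<in> E0 ^^ j" if "(x, y) \<in> E0 ^^ j" for x y j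
    using sym_relpow[OF sym_E0] that by (metis symD)
  have sym: "(y, x) \<in> step\<^sup>*" if "(x, y) \<in> step\<^sup>*" for x y
    using that sym_step by (metis sym_rtrancl symI symD)
  show "(u, v) \<in> E0 ^^ (2 * bound)"
  \<comment> \<open>A component with a visible vertex is measured from there, which costs the factor
    2; any other lies in one layer around one adhesion set.\<close>
  proof (cases "\<exists>w. (u, w) \<in> step\<^sup>* \<and> \<not> hidden w")
    case True
    then obtain w where w: "(u, w) \<in> step\<^sup>*" "\<not> hidden w" by blast
    have "(w, v) \<in> step\<^sup>*" using rtrancl_trans[OF sym[OF w(1)] uv] .
    from relpow_trans[OF symE0[OF visible_bounded[OF sym[OF w(1)] w(2)]]
        visible_bounded[OF this w(2)]]
    show ?thesis by (simp add: mult_2)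
  next
    case False
    then have "(prj u, prj v) \<in> (adh_step (home u))\<^sup>*" using hidden_chain[OF uv] by blast
    then have "(prj u, prj v) \<in> E ^^ M" using adh_chain by blast
    note E_dist_E0[OF relpow_trans[OF relpow_trans[OF prj_dist this] dist_sym[OF prj_dist]]]
    moreover have "R * (2 * r + M + 2 * r) \<le> 2 * bound"
      by (simp add: bound_def Let_def algebra_simps)
    ultimately show ?thesis using relpow_mono_exp[OF refl_E0] by blast
  qed
qed

end

section \<open>Induction on the adhesion\<close>

definition fine_colouring :: "nat \<Rightarrow> 'v rel \<Rightarrow> (nat \<Rightarrow> nat) \<Rightarrow> 'v set \<Rightarrow> bool" where
  "fine_colouring n E0 D A \<longleftrightarrow> (\<forall>j. \<exists>f. (\<forall>v. f v \<le> n) \<and>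
    {(u, v). u \<in> A \<and> v \<in> A \<and> f u = f v \<and> (u, v) \<in> E0 ^^ j}\<^sup>* \<subseteq> E0 ^^ D j)"

text \<open>Distances are ambient, so passing to a subset only removes chains. This is why deleting
  balls from the bags is harmless.\<close>

lemma fine_colouring_mono: "fine_colouring n E0 D A \<Longrightarrow> B \<subseteq> A \<Longrightarrow> fine_colouring n E0 D B"
  unfolding fine_colouring_def
proof (intro allI)
  fix j
  assume *: "\<forall>j. \<exists>f. (\<forall>v. f v \<le> n) \<and>
    {(u, v). u \<in> A \<and> v \<in> A \<and> f u = f v \<and> (u, v) \<in> E0 ^^ j}\<^sup>* \<subseteq> E0 ^^ D j" and BA: "B \<subseteq> A"
  then obtain f where f: "\<forall>v. f v \<le> n"
    "{(u, v). u \<in> A \<and> v \<in> A \<and> f u = f v \<and> (u, v) \<in> E0 ^^ j}\<^sup>* \<subseteq> E0 ^^ D j" by blast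
  have "{(u, v). u \<in> B \<and> v \<in> B \<and> f u = f v \<and> (u, v) \<in> E0 ^^ j}
      \<subseteq> {(u, v). u \<in> A \<and> v \<in> A \<and> f u = f v \<and> (u, v) \<in> E0 ^^ j}" using BA by auto
  from rtrancl_mono[OF this] show "\<exists>f. (\<forall>v. f v \<le> n) \<and>
    {(u, v). u \<in> B \<and> v \<in> B \<and> f u = f v \<and> (u, v) \<in> E0 ^^ j}\<^sup>* \<subseteq> E0 ^^ D j"
    using f by blast
qed

text \<open>\<open>b\<close> precedes the quantifiers over graph and decomposition: this is the
  uniformity that one control function for a whole class requires. \<open>r\<close> and
  \<open>R\<close> are generalised because the step uses the hypothesis at scale \<open>M\<close>
  with \<open>R * M\<close>.\<close>

lemma tree_like_colouring:
  assumes "1 \<le> n"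
  shows "\<exists>b. \<forall>E0 E (X :: 't \<Rightarrow> 'v set) p m \<tau>. rooted_bags X p m \<tau> \<longrightarrow>
    Id \<subseteq> E0 \<longrightarrow> sym E0 \<longrightarrow> Id \<subseteq> E \<longrightarrow> sym E \<longrightarrow> E \<subseteq> E0 ^^ R \<longrightarrow>
    (\<forall>(x, y)\<in>E. x \<noteq> y \<longrightarrow> (\<exists>a. x \<in> X a \<and> y \<in> X a)) \<longrightarrow>
    (\<forall>a. finite (rooted_bags.adh X p m a) \<and> card (rooted_bags.adh X p m a) \<le> k) \<longrightarrow>
    (\<forall>a. fine_colouring n E0 D (X a)) \<longrightarrow>
    (\<exists>f. (\<forall>v. f v \<le> n) \<and> {(u, v). f u = f v \<and> (u, v) \<in> E ^^ r}\<^sup>* \<subseteq> E0 ^^ b)"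
proof (induction k arbitrary: r R)
  case 0
  show ?case
  proof (intro exI[of _ "D (R * r)"] allI impI)
    fix E0 E and X :: "'t \<Rightarrow> 'v set" and p m \<tau>
    assume rb: "rooted_bags X p m \<tau>" and E0: "Id \<subseteq> E0" "sym E0" and E: "Id \<subseteq> E" "sym E"
      "E \<subseteq> E0 ^^ R" and bags: "\<forall>(x, y)\<in>E. x \<noteq> y \<longrightarrow> (\<exists>a. x \<in> X a \<and> y \<in> X a)"
      and ad: "\<forall>a. finite (rooted_bags.adh X p m a) \<and> card (rooted_bags.adh X p m a) \<le> 0"
      and good: "\<forall>a. fine_colouring n E0 D (X a)"
    interpret rooted_bags X p m \<tau> by fact
    have adh: "adh a = {}" for a using ad by (metis card_0_eq le_zero_eq)
    \<comment> \<open>With empty adhesion sets no vertex has a second bag, so a walk that moves at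
      all stays in one bag.\<close>
    have one: "a = \<tau> v" if "v \<in> X a" for v a
      using up[OF that] adh[of a] that by (auto simp: adh_def split: if_splits)
    have E_same: "x = y \<or> x \<in> X (\<tau> x) \<and> y \<in> X (\<tau> x)" if "(x, y) \<in> E" for x y
      using bags that one by fastforce
    have walk: "x = y \<or> x \<in> X (\<tau> x) \<and> y \<in> X (\<tau> x)" if "(x, y) \<in> E ^^ j" for x y j
      using that
    proof (induction j arbitrary: y)
      case (Suc j)
      then obtain z where "(x, z) \<in> E ^^ j" "(z, y) \<in> E" by auto
      then show ?case using Suc.IH E_same one by metis
    qed simp
    have "\<forall>a. \<exists>f. (\<forall>v. f v \<le> n) \<and> {(u, v). u \<in> X a \<and> v \<in> X a \<and> f u = f v \<and>
        (u, v) \<in> E0 ^^ (R * r)}\<^sup>* \<subseteq> E0 ^^ D (R * r)"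
      using good by (simp add: fine_colouring_def)
    from choice[OF this] obtain f where f: "\<And>a v. f a v \<le> n"
      "\<And>a. {(u, v). u \<in> X a \<and> v \<in> X a \<and> f a u = f a v \<and>
        (u, v) \<in> E0 ^^ (R * r)}\<^sup>* \<subseteq> E0 ^^ D (R * r)" by blast
    show "\<exists>f. (\<forall>v. f v \<le> n) \<and> {(u, v). f u = f v \<and> (u, v) \<in> E ^^ r}\<^sup>* \<subseteq> E0 ^^ D (R * r)"
    proof (intro exI[of _ "\<lambda>v. f (\<tau> v) v"] conjI allI f(1) subrelI)
      fix u v assume "(u, v) \<in> {(u, v). f (\<tau> u) u = f (\<tau> v) v \<and> (u, v) \<in> E ^^ r}\<^sup>*"
      then have "(u, v) \<in> {(x, y). x \<in> X (\<tau> u) \<and> y \<in> X (\<tau> u) \<and> f (\<tau> u) x = f (\<tau> u) y \<and>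
        (x, y) \<in> E0 ^^ (R * r)}\<^sup>* \<and> \<tau> v = \<tau> u"
      proof (induction rule: rtrancl_induct)
        case (step v w)
        then have vw: "(v, w) \<in> E ^^ r" "f (\<tau> v) v = f (\<tau> w) w" by auto
        show ?case
        proof (cases "v = w")
          case False
          have e: "(v, w) \<in> E0 ^^ (R * r)" using relpow_relpow_subset[OF E(3)] vw(1) by blast
          from False have x: "v \<in> X (\<tau> v)" "w \<in> X (\<tau> v)" using walk[OF vw(1)] by auto
          then have tw: "\<tau> w = \<tau> v" using one by metis
          have "(v, w) \<in> {(x, y). x \<in> X (\<tau> u) \<and> y \<in> X (\<tau> u) \<and> f (\<tau> u) x = f (\<tau> u) y \<and>
            (x, y) \<in> E0 ^^ (R * r)}" using e x tw vw step.IH by simp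
          then show ?thesis using step.IH tw by (auto intro: rtrancl_into_rtrancl)
        qed (use step in simp)
      qed simp
      then show "(u, v) \<in> E0 ^^ D (R * r)" using f(2) by blast
    qed
  qed
next
  case (Suc k)
  \<comment> \<open>The layers need positive thickness; links of length \<open>r\<close> are also
    links of length \<open>r'\<close>.\<close>
  define r' where "r' = Suc r"
  define M where "M = 5 * r' * (Suc k * Suc k)"
  from Suc.IH[of "R * M" M] obtain b where b: "\<And>E0 E (X :: 't \<Rightarrow> 'v set) p m \<tau>.
    rooted_bags X p m \<tau> \<Longrightarrow>
    Id \<subseteq> E0 \<Longrightarrow> sym E0 \<Longrightarrow> Id \<subseteq> E \<Longrightarrow> sym E \<Longrightarrow> E \<subseteq> E0 ^^ (R * M) \<Longrightarrow>
    (\<forall>(x, y)\<in>E. x \<noteq> y \<longrightarrow> (\<exists>a. x \<in> X a \<and> y \<in> X a)) \<Longrightarrow>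
    (\<forall>a. finite (rooted_bags.adh X p m a) \<and> card (rooted_bags.adh X p m a) \<le> k) \<Longrightarrow>
    (\<forall>a. fine_colouring n E0 D (X a)) \<Longrightarrow>
    \<exists>f. (\<forall>v. f v \<le> n) \<and> {(u, v). f u = f v \<and> (u, v) \<in> E ^^ M}\<^sup>* \<subseteq> E0 ^^ b"
    by blast
  show ?case
  proof (intro exI[of _ "2 * region_colouring.bound r' R b (Suc k) M"] allI impI)
    fix E0 E and X :: "'t \<Rightarrow> 'v set" and p m \<tau>
    assume rb: "rooted_bags X p m \<tau>" and E0: "Id \<subseteq> E0" "sym E0" and E: "Id \<subseteq> E" "sym E"
      "E \<subseteq> E0 ^^ R" and bags: "\<forall>(x, y)\<in>E. x \<noteq> y \<longrightarrow> (\<exists>a. x \<in> X a \<and> y \<in> X a)"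
      and ad: "\<forall>a. finite (rooted_bags.adh X p m a) \<and> card (rooted_bags.adh X p m a) \<le> Suc k"
      and good: "\<forall>a. fine_colouring n E0 D (X a)"
    interpret region_step X p m \<tau> E r'
      using rb E bags by (auto simp: region_step_def region_step_axioms_def r'_def)
    have "\<exists>f. (\<forall>v. f v \<le> n) \<and> {(u, v). f u = f v \<and> (u, v) \<in> inner M s ^^ M}\<^sup>* \<subseteq> E0 ^^ b" for s
    proof (rule b[OF rooted_region_bag E0 refl_inner sym_inner])
      show "inner M s \<subseteq> E0 ^^ (R * M)"
        using inner_subset relpow_relpow_subset[OF E(3)] by blast
      show "\<forall>(x, y)\<in>inner M s. x \<noteq> y \<longrightarrow> (\<exists>a. x \<in> region_bag s a \<and> y \<in> region_bag s a)"
        by (auto simp: inner_def)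
      show "\<forall>a. finite (rooted_bags.adh (region_bag s) p m a) \<and>
          card (rooted_bags.adh (region_bag s) p m a) \<le> k"
        using card_adh_region_bag ad by blast
      have "region_bag s a \<subseteq> X a" for a by (auto simp: region_bag_def)
      then show "\<forall>a. fine_colouring n E0 D (region_bag s a)" using good fine_colouring_mono by blast
    qed
    then have "\<forall>s. \<exists>f. (\<forall>v. f v \<le> n) \<and> {(u, v). f u = f v \<and> (u, v) \<in> inner M s ^^ M}\<^sup>* \<subseteq> E0 ^^ b"
      by blast
    from choice[OF this] obtain c where c: "\<And>s v. c s v \<le> n"
      "\<And>s. {(u, v). c s u = c s v \<and> (u, v) \<in> inner M s ^^ M}\<^sup>* \<subseteq> E0 ^^ b" by blast
    interpret region_colouring X p m \<tau> E r' c E0 R b "Suc k" M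
      by unfold_locales (use E0 E(3) ad c(2) M_def in auto)
    have mono: "{(u, v). colour u = colour v \<and> (u, v) \<in> E ^^ r} \<subseteq> step"
      using dist_mono[of _ _ r r'] by (auto simp: step_def) (simp add: r'_def)
    show "\<exists>f. (\<forall>v. f v \<le> n) \<and> {(u, v). f u = f v \<and> (u, v) \<in> E ^^ r}\<^sup>*
        \<subseteq> E0 ^^ (2 * region_colouring.bound r' R b (Suc k) M)"
    proof (intro exI[of _ colour] conjI allI)
      fix v show "colour v \<le> n" using c(1) assms by (simp add: colour_def)
    next
      show "{(u, v). colour u = colour v \<and> (u, v) \<in> E ^^ r}\<^sup>*
        \<subseteq> E0 ^^ (2 * region_colouring.bound r' R b (Suc k) M)"
        using rtrancl_mono[OF mono] step_bounded by blast
    qed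
  qed
qed

subsection \<open>Rooting a tree-decomposition\<close>

lemma rtrancl_on_subset: "rtrancl_on F r \<subseteq> r\<^sup>*"
proof (rule subrelI)
  fix a b assume "(a, b) \<in> rtrancl_on F r"
  then show "(a, b) \<in> r\<^sup>*"
    by (induction rule: rtrancl_on_induct) (auto intro: rtrancl_into_rtrancl)
qed

lemma connected_induced_rtrancl:
  assumes "Digraph_Component.connected (with_proj T \<restriction> S)" "sym (parcs T)" "u \<in> S" "v \<in> S"
  shows "(u, v) \<in> (parcs T \<inter> S \<times> S)\<^sup>*"
proof -
  let ?H = "with_proj T \<restriction> S"
  have "(u, v) \<in> rtrancl_on S (parcs (mk_symmetric ?H))"
    using assms unfolding Digraph_Component.connected_def strongly_connected_def reachable_def
    by simp
  moreover have "parcs (mk_symmetric ?H) \<subseteq> parcs T \<inter> S \<times> S"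
    using assms(2) by (auto simp: parcs_mk_symmetric dest: symD)
  ultimately show ?thesis using rtrancl_on_subset rtrancl_mono by blast
qed

lemma pair_graph_sym: "pair_graph G \<Longrightarrow> sym (parcs G)"
  using pair_sym_digraph.arcs_symmetric[of G]
  by (auto simp: sym_def pair_graph_def pair_pseudo_graph_def)

lemma connected_rtrancl:
  assumes "Digraph_Component.connected (with_proj T)" "pair_graph T" "u \<in> pverts T" "v \<in> pverts T"
  shows "(u, v) \<in> (parcs T)\<^sup>*"
proof -
  have "(u, v) \<in> rtrancl_on (pverts T) (parcs (mk_symmetric (with_proj T)))"
    using assms unfolding Digraph_Component.connected_def strongly_connected_def reachable_def
    by simp
  moreover have "parcs (mk_symmetric (with_proj T)) \<subseteq> parcs T"
    using pair_graph_sym[OF assms(2)] by (auto simp: parcs_mk_symmetric dest: symD)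
  ultimately show ?thesis using rtrancl_on_subset rtrancl_mono by blast
qed

lemma pawalk_verts_snoc: "pcas a p b \<Longrightarrow> pawalk_verts a (p @ [(b, x)]) = pawalk_verts a p @ [x]"
  by (induction p arbitrary: a) auto

lemma set_pawalk_verts: "set (pawalk_verts a p) \<subseteq> insert a (fst ` set p \<union> snd ` set p)"
  by (induction p arbitrary: a) auto

text \<open>Shorten the walk to a path and close it through \<open>x\<close>. As
  \<open>a \<noteq> b\<close>, the path is nonempty, so the cycle is not just a pair of opposite
  arcs.\<close>

lemma cycle_through_vertex:
  assumes T: "pair_graph T" and xa: "(x, a) \<in> parcs T" and xb: "(x, b) \<in> parcs T" and "a \<noteq> b"
    and ab: "(a, b) \<in> (parcs T \<inter> (- {x}) \<times> (- {x}))\<^sup>*"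
  shows "\<exists>p. pre_digraph.cycle (with_proj T) p \<and> 3 \<le> length p"
proof -
  interpret pair_graph T by fact
  have "\<exists>p. awalk a p b \<and> (\<forall>e\<in>set p. fst e \<noteq> x \<and> snd e \<noteq> x)"
    using ab
  proof (induction rule: rtrancl_induct)
    case base
    then show ?case
      using in_arcsD2[OF xa] by (intro exI[of _ "[]"]) (simp add: awalk_Nil_iff)
  next
    case (step y z)
    then obtain p where p: "awalk a p y" "\<forall>e\<in>set p. fst e \<noteq> x \<and> snd e \<noteq> x" by blast
    have "awalk y [(y, z)] z"
      using step.hyps(2) in_arcsD1[of y z] in_arcsD2[of y z] by (simp add: awalk_simps)
    then have "awalk a (p @ [(y, z)]) z" using p(1) by auto
    then show ?case using p(2) step.hyps(2) by (intro exI[of _ "p @ [(y, z)]"]) auto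
  qed
  then obtain p where p: "awalk a p b" "\<forall>e\<in>set p. fst e \<noteq> x \<and> snd e \<noteq> x" by blast
  define q where "q = awalk_to_apath p"
  have q: "apath a q b" "\<forall>e\<in>set q. fst e \<noteq> x \<and> snd e \<noteq> x"
    using apath_awalk_to_apath[OF p(1)] awalk_to_apath_subset[OF p(1)] p(2) by (auto simp: q_def)
  have aw: "awalk a q b" "distinct (pawalk_verts a q)" using q(1) by (auto simp: apath_def)
  have "q \<noteq> []" using aw(1) \<open>a \<noteq> b\<close> by (auto simp: awalk_Nil_iff)
  let ?c = "(x, a) # q @ [(b, x)]"
  have "awalk b [(b, x)] x"
    using arcs_symmetric[OF xb] in_arcsD1[OF xb] in_arcsD2[OF xb] by (simp add: awalk_simps)
  then have "awalk a (q @ [(b, x)]) x" using aw(1) by auto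
  then have "awalk x ((x, a) # (q @ [(b, x)])) x" unfolding awalk_Cons_iff using xa by simp
  moreover have "x \<noteq> a" using xa no_loops' by blast
  then have "x \<notin> set (pawalk_verts a q)" using set_pawalk_verts[of a q] q(2) by fastforce
  then have "distinct (tl (pawalk_verts x ?c))"
    using aw(2) aw(1) by (simp add: pawalk_verts_snoc awalk_def)
  ultimately have "cycle ?c" unfolding cycle_def by blast
  moreover have "3 \<le> length ?c" using \<open>q \<noteq> []\<close> by (cases q) auto
  ultimately show ?thesis by blast
qed

text \<open>\<open>m\<close> is the distance from \<open>t\<close>. Two neighbours of
  \<open>x\<close> no deeper than \<open>x\<close> could be joined through the root while avoiding
  \<open>x\<close>, which closes a cycle.\<close>

lemma undirected_tree_rooted:
  assumes T: "undirected_tree T" and t: "t \<in> pverts T"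
  shows "\<exists>p m. m t = (0 :: nat) \<and>
    (\<forall>(a, b)\<in>parcs T. b = p a \<and> m b < m a \<or> a = p b \<and> m a < m b) \<and>
    (\<forall>a\<in>pverts T. m (p a) < m a \<longrightarrow> (a, p a) \<in> parcs T)"
proof -
  have pg: "pair_graph T" and con: "Digraph_Component.connected (with_proj T)"
    and acyc: "\<not> (\<exists>p. pre_digraph.cycle (with_proj T) p \<and> 3 \<le> length p)"
    using T by (auto simp: undirected_tree_def)
  interpret pair_graph T by fact
  note sym = pair_graph_sym[OF pg]
  define m where "m a = (LEAST l. (t, a) \<in> parcs T ^^ l)" for a
  have m_walk: "(t, a) \<in> parcs T ^^ m a" if a: "a \<in> pverts T" for a
  proof -
    obtain l where "(t, a) \<in> parcs T ^^ l"
      using connected_rtrancl[OF con pg t a] rtrancl_imp_relpow by blast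
    then show ?thesis unfolding m_def by (rule LeastI)
  qed
  have m_le: "m a \<le> l" if "(t, a) \<in> parcs T ^^ l" for a l
    unfolding m_def using that by (rule Least_le)
  have mt: "m t = 0" using m_le[of t 0] by simp
  have root: "a = t" if "a \<in> pverts T" "m a = 0" for a using m_walk[OF that(1)] that(2) by simp
  have parent: "\<exists>b. (a, b) \<in> parcs T \<and> m b < m a" if a: "a \<in> pverts T" "m a \<noteq> 0" for a
  proof -
    obtain l where l: "m a = Suc l" using a(2) not0_implies_Suc by blast
    then obtain b where b: "(t, b) \<in> parcs T ^^ l" "(b, a) \<in> parcs T" using m_walk[OF a(1)] by auto
    then show ?thesis using m_le[OF b(1)] l sym by (auto dest: symD)
  qed
  have desc: "(t, a) \<in> (parcs T \<inter> (- {x}) \<times> (- {x}))\<^sup>*" if "a \<in> pverts T" "m a \<le> m x" "a \<noteq> x" for a x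
    using that
  proof (induction "m a" arbitrary: a rule: less_induct)
    case less
    show ?case
    proof (cases "m a = 0")
      case True then show ?thesis using root less.prems by simp
    next
      case False
      then obtain b where b: "(a, b) \<in> parcs T" "m b < m a" using parent less.prems by blast
      then have "b \<in> pverts T" "m b \<le> m x" "b \<noteq> x" using less.prems in_arcsD2 by auto
      then have "(t, b) \<in> (parcs T \<inter> (- {x}) \<times> (- {x}))\<^sup>*" using less.hyps b(2) by blast
      moreover have "(b, a) \<in> parcs T \<inter> (- {x}) \<times> (- {x})"
        using b(1) \<open>b \<noteq> x\<close> less.prems sym by (auto dest: symD)
      ultimately show ?thesis by (rule rtrancl_into_rtrancl)
    qed
  qed
  \<comment> \<open>The bounds are not strict: compared with the parent, this also rules out arcs
    between vertices of equal depth.\<close>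
  have unique: "a = b" if "(x, a) \<in> parcs T" "m a \<le> m x" "(x, b) \<in> parcs T" "m b \<le> m x" for x a b
  proof (rule ccontr)
    assume "a \<noteq> b"
    let ?R = "parcs T \<inter> (- {x}) \<times> (- {x})"
    have ne: "a \<noteq> x" "b \<noteq> x" using that no_loops' by blast+
    have "(t, a) \<in> ?R\<^sup>*" "(t, b) \<in> ?R\<^sup>*" using desc ne that in_arcsD2 by blast+
    moreover have "sym (?R\<^sup>*)" using sym by (intro sym_rtrancl) (auto simp: sym_def)
    ultimately have "(a, b) \<in> ?R\<^sup>*" by (meson rtrancl_trans symD)
    then show False using cycle_through_vertex[OF pg that(1,3) \<open>a \<noteq> b\<close>] acyc by blast
  qed
  define p where "p a = (SOME b. (a, b) \<in> parcs T \<and> m b < m a)" for a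
  have p: "(a, p a) \<in> parcs T \<and> m (p a) < m a" if "a \<in> pverts T" "m a \<noteq> 0" for a
    unfolding p_def using someI_ex[OF parent[OF that]] .
  have down: "b = p a \<and> m b < m a" if ab: "(a, b) \<in> parcs T" "m b \<le> m a" for a b
  proof -
    have "m a \<noteq> 0"
    proof
      assume "m a = 0"
      then have "a = t" "b = t" using root ab in_arcsD1 in_arcsD2 by auto
      then show False using ab no_loops' by blast
    qed
    then have pa: "(a, p a) \<in> parcs T" "m (p a) < m a" using p ab in_arcsD1 by blast+
    then have "b = p a" using unique[OF ab pa(1)] by simp
    then show ?thesis using pa by simp
  qed
  show ?thesis
  proof (intro exI[of _ p] exI[of _ m] conjI mt ballI impI)
    fix e assume "e \<in> parcs T"
    then obtain a b where e: "e = (a, b)" and ab: "(a, b) \<in> parcs T" by (cases e) auto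
    show "case e of (a, b) \<Rightarrow> b = p a \<and> m b < m a \<or> a = p b \<and> m a < m b"
      unfolding e prod.case using down[OF ab] down[OF symD[OF sym ab]] nat_le_linear by blast
  next
    fix a assume "a \<in> pverts T" "m (p a) < m a"
    then show "(a, p a) \<in> parcs T" using p by auto
  qed
qed

lemma tree_decompositionD:
  assumes "tree_decomposition G T X"
  shows "undirected_tree T" "\<forall>a\<in>pverts T. X a \<subseteq> pverts G"
    "\<forall>(u, v)\<in>parcs G. \<exists>a\<in>pverts T. u \<in> X a \<and> v \<in> X a"
    "\<forall>v\<in>pverts G. Digraph_Component.connected (with_proj T \<restriction> {a \<in> pverts T. v \<in> X a})"
proof -
  note D = assms[unfolded tree_decomposition_def]
  show "undirected_tree T" by (rule D[THEN conjunct1])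
  show "\<forall>a\<in>pverts T. X a \<subseteq> pverts G" by (rule D[THEN conjunct2, THEN conjunct1])
  show "\<forall>(u, v)\<in>parcs G. \<exists>a\<in>pverts T. u \<in> X a \<and> v \<in> X a"
    by (rule D[THEN conjunct2, THEN conjunct2, THEN conjunct2, THEN conjunct1])
  show "\<forall>v\<in>pverts G. Digraph_Component.connected (with_proj T \<restriction> {a \<in> pverts T. v \<in> X a})"
    by (rule D[THEN conjunct2, THEN conjunct2, THEN conjunct2, THEN conjunct2])
qed

text \<open>If the parent of a bag \<open>a\<close> containing \<open>v\<close> did not contain \<open>v\<close>, then all bags with \<open>v\<close> would
  be descendants of \<open>a\<close>, so \<open>a\<close> would be the one closest to the root.\<close>

lemma tree_decomposition_rooted:
  assumes td: "tree_decomposition G T X" and t: "t \<in> pverts T"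
  shows "\<exists>p m \<tau>. m t = (0 :: nat) \<and>
    rooted_bags (\<lambda>a. if a \<in> pverts T then X a else {}) p m \<tau> \<and>
    (\<forall>a\<in>pverts T. m (p a) < m a \<longrightarrow> (a, p a) \<in> parcs T)"
proof -
  have T: "undirected_tree T" and V: "\<forall>a\<in>pverts T. X a \<subseteq> pverts G"
    and con: "\<forall>v\<in>pverts G. Digraph_Component.connected (with_proj T \<restriction> {a \<in> pverts T. v \<in> X a})"
    by (fact tree_decompositionD[OF td])+
  obtain p m where m: "m t = (0 :: nat)"
    and edge: "\<forall>(a, b)\<in>parcs T. b = p a \<and> m b < m a \<or> a = p b \<and> m a < m b"
    and par: "\<forall>a\<in>pverts T. m (p a) < m a \<longrightarrow> (a, p a) \<in> parcs T"
    using undirected_tree_rooted[OF T t] by blast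
  define \<tau> where "\<tau> v = arg_min m (\<lambda>a. a \<in> pverts T \<and> v \<in> X a)" for v
  have symT: "sym (parcs T)" using T by (intro pair_graph_sym) (simp add: undirected_tree_def)
  have "rooted_bags (\<lambda>a. if a \<in> pverts T then X a else {}) p m \<tau>"
  proof
    fix v a assume "v \<in> (if a \<in> pverts T then X a else {})" and ne: "a \<noteq> \<tau> v"
    then have a: "a \<in> pverts T \<and> v \<in> X a" by (auto split: if_splits)
    let ?S = "{a \<in> pverts T. v \<in> X a}"
    let ?D = "{(s, p s) | s. m (p s) < m s}"
    have \<tau>: "\<tau> v \<in> pverts T \<and> v \<in> X (\<tau> v)" and min: "m (\<tau> v) \<le> m a"
      unfolding \<tau>_def using arg_min_nat_lemma[of "\<lambda>a. a \<in> pverts T \<and> v \<in> X a", OF a, of m] a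
      by auto
    have "v \<in> pverts G" using V a by blast
    then have path: "(a, \<tau> v) \<in> (parcs T \<inter> ?S \<times> ?S)\<^sup>*"
      using connected_induced_rtrancl[OF con[rule_format] symT] a \<tau> by simp
    have "p a \<in> ?S \<and> m (p a) < m a"
    proof (rule ccontr)
      assume not: "\<not> ?thesis"
      from path have "(\<tau> v, a) \<in> ?D\<^sup>*"
      proof (induction rule: rtrancl_induct)
        case (step s s')
        have st: "(s, s') \<in> parcs T" "s \<in> ?S" "s' \<in> ?S" using step.hyps(2) by auto
        from bspec[OF edge st(1)] have "s' = p s \<and> m s' < m s \<or> s = p s' \<and> m s < m s'" by simp
        then show ?case
        proof (elim disjE conjE)
          assume s': "s' = p s" "m s' < m s"
          have "s \<noteq> a" using not s' st(3) by blast
          then obtain s'' where "(s, s'') \<in> ?D" "(s'', a) \<in> ?D\<^sup>*"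
            using step.IH by (meson converse_rtranclE)
          then show ?thesis using s'(1) by blast
        next
          assume "s = p s'" "m s < m s'"
          then have "(s', s) \<in> ?D" by blast
          then show ?thesis using step.IH by (rule converse_rtrancl_into_rtrancl)
        qed
      qed simp
      moreover have "x = y \<or> m y < m x" if "(x, y) \<in> ?D\<^sup>*" for x y
        using that by (induction rule: rtrancl_induct) auto
      ultimately show False using ne min by fastforce
    qed
    then show "m (p a) < m a \<and> v \<in> (if p a \<in> pverts T then X (p a) else {})" by auto
  qed
  then show ?thesis using m par by blast
qed

subsection \<open>Control functions and colourings\<close>

abbreviation adj :: "'v pair_pre_digraph \<Rightarrow> 'v rel" where
  "adj G \<equiv> Id \<union> parcs G"

lemma awalk_cost_one: "wf_digraph.awalk_cost (\<lambda>_. 1) p = real (length p)"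
  if "wf_digraph G" for G :: "('v, 'e) pre_digraph" and p :: "'e list"
  using wf_digraph.awalk_cost_def[OF that] by (simp add: sum_list_triv)

lemma awalk_adj:
  assumes "pair_wf_digraph G" "pre_digraph.awalk (with_proj G) u p v"
  shows "(u, v) \<in> adj G ^^ length p \<and> u \<in> pverts G \<and> v \<in> pverts G"
proof -
  interpret pair_wf_digraph G by fact
  show ?thesis using assms(2)
  proof (induction p arbitrary: u)
    case Nil then show ?case by (auto simp: awalk_Nil_iff)
  next
    case (Cons e p)
    then have "(u, snd e) \<in> adj G" "(snd e, v) \<in> adj G ^^ length p" "u \<in> pverts G" "v \<in> pverts G"
      by (auto simp: awalk_Cons_iff)
    then show ?case using relpow_Suc_I2 by (metis length_Cons)
  qed
qed

lemma adj_awalk: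
  assumes "pair_wf_digraph G" "(u, v) \<in> adj G ^^ l" "u \<in> pverts G"
  shows "\<exists>p. pre_digraph.awalk (with_proj G) u p v \<and> length p \<le> l"
proof -
  interpret pair_wf_digraph G by fact
  show ?thesis using assms(2)
  proof (induction l arbitrary: v)
    case 0 then show ?case using assms(3) by (intro exI[of _ "[]"]) (simp add: awalk_Nil_iff)
  next
    case (Suc l)
    then obtain w where w: "(u, w) \<in> adj G ^^ l" "(w, v) \<in> adj G" by auto
    obtain p where p: "awalk u p w" "length p \<le> l" using Suc.IH[OF w(1)] by blast
    show ?case
    proof (cases "w = v")
      case True then show ?thesis using p by (intro exI[of _ p]) simp
    next
      case False
      then have e: "(w, v) \<in> parcs G" using w(2) by simp
      then have "awalk w [(w, v)] v"
        using in_arcsD1[OF e] in_arcsD2[OF e] by (simp add: awalk_simps)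
      then have "awalk u (p @ [(w, v)]) v" using p(1) by auto
      then show ?thesis using p(2) by (intro exI[of _ "p @ [(w, v)]"]) simp
    qed
  qed
qed

lemma graph_dist_leD:
  assumes "pair_wf_digraph G" "graph_dist G u v \<le> ereal x"
  shows "(u, v) \<in> adj G ^^ nat \<lfloor>x\<rfloor> \<and> u \<in> pverts G \<and> v \<in> pverts G"
proof -
  interpret pair_wf_digraph G by fact
  \<comment> \<open>A strict bound is needed to extract a walk from the infimum; lengths are
    integers, so nothing is lost.\<close>
  have "graph_dist G u v < ereal (of_int (\<lfloor>x\<rfloor> + 1))"
    using assms(2) by (rule le_less_trans) (simp only: ereal_less_eq less_ereal.simps, linarith)
  then obtain p where p: "awalk u p v" "ereal (awalk_cost (\<lambda>_. 1) p) < ereal (of_int (\<lfloor>x\<rfloor> + 1))"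
    unfolding graph_dist_def \<mu>_def INF_less_iff by auto
  then have "real (length p) < of_int (\<lfloor>x\<rfloor> + 1)"
    using awalk_cost_one[OF wf_digraph_axioms] by simp
  then have "length p \<le> nat \<lfloor>x\<rfloor>" by linarith
  then show ?thesis using awalk_adj[OF assms(1) p(1)] relpow_mono_exp[of "adj G"] by blast
qed

lemma graph_dist_leI:
  assumes "pair_wf_digraph G" "(u, v) \<in> adj G ^^ l" "u \<in> pverts G" "real l \<le> x"
  shows "graph_dist G u v \<le> ereal x"
proof -
  interpret pair_wf_digraph G by fact
  obtain p where p: "awalk u p v" "length p \<le> l" using adj_awalk[OF assms(1-3)] by blast
  have "graph_dist G u v \<le> ereal (awalk_cost (\<lambda>_. 1) p)"
    unfolding graph_dist_def by (rule min_cost_le_walk_cost[OF p(1)])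
  also have "\<dots> \<le> ereal x" using p(2) assms(4) awalk_cost_one[OF wf_digraph_axioms] by simp
  finally show ?thesis .
qed

text \<open>Each vertex takes the index of one family covering it. By disjointness at scale
  \<open>s\<close>, a chain with constant index cannot change the member, so it stays in one bounded
  set.\<close>

lemma control_function_colouring:
  assumes "control_function k M d D" "0 < s"
  shows "\<exists>f :: 'a \<Rightarrow> nat. (\<forall>v. f v \<le> k) \<and> (\<forall>u v. u \<in> M \<longrightarrow>
    (u, v) \<in> {(u, v). u \<in> M \<and> v \<in> M \<and> f u = f v \<and> d u v \<le> ereal s}\<^sup>* \<longrightarrow> d u v \<le> ereal (D s))"
proof -
  note C = assms(1)[unfolded control_function_def, rule_format, OF assms(2), THEN conjunct2]
  obtain \<U> where U': "(\<Union>i\<in>{1..k + 1}. \<Union>(\<U> i)) = M \<and>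
    (\<forall>i\<in>{1..k + 1}. r_disjoint d s (\<U> i) \<and> bounded_family d (D s) (\<U> i))"
    using C by (rule exE)
  note U = U'[THEN conjunct1] U'[THEN conjunct2, rule_format]
  have "\<forall>v. \<exists>i. v \<in> M \<longrightarrow> i \<in> {1..k + 1} \<and> v \<in> \<Union>(\<U> i)" using U(1) by blast
  from choice[OF this] obtain g where g: "\<And>v. v \<in> M \<Longrightarrow> g v \<in> {1..k + 1} \<and> v \<in> \<Union>(\<U> (g v))"
    by blast
  define f where "f v = (if v \<in> M then g v - 1 else 0)" for v
  have gf: "g v = Suc (f v)" if "v \<in> M" for v using g[OF that] that by (simp add: f_def)
  have "f v \<le> k" for v using g[of v] by (auto simp: f_def)
  moreover have "d u v \<le> ereal (D s)" if u: "u \<in> M" and uv: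
    "(u, v) \<in> {(u, v). u \<in> M \<and> v \<in> M \<and> f u = f v \<and> d u v \<le> ereal s}\<^sup>*" for u v
  proof -
    obtain A where A: "A \<in> \<U> (g u)" "u \<in> A" using g[OF u] by blast
    from uv have "v \<in> A \<and> v \<in> M \<and> g v = g u"
    proof (induction rule: rtrancl_induct)
      case base then show ?case using A u by simp
    next
      case (step v w)
      then have w: "w \<in> M" "g w = g u" "d v w \<le> ereal s" using gf by auto
      obtain B where B: "B \<in> \<U> (g u)" "w \<in> B" using g[OF w(1)] w(2) by auto
      have "A = B"
      proof (rule ccontr)
        assume "A \<noteq> B"
        then have "ereal s < d v w"
          using U(2)[of "g u"] g[OF u] A(1) B step.IH unfolding r_disjoint_def by blast
        then show False using w(3) by simp
      qed
      then show ?case using B w by simp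
    qed
    then have "v \<in> A" by simp
    have "d u v \<le> ediameter d A"
      unfolding ediameter_def by (rule SUP_upper2[OF A(2)], rule SUP_upper[OF \<open>v \<in> A\<close>])
    also have "\<dots> \<le> ereal (D s)"
      using U(2)[of "g u"] g[OF u] A(1) unfolding bounded_family_def by blast
    finally show ?thesis .
  qed
  ultimately show ?thesis by blast
qed

text \<open>The families consist of the monochromatic components. The summand 1 keeps the control
  function positive when \<open>b = 0\<close>.\<close>

lemma colouring_control:
  fixes G :: "'v pair_pre_digraph" and f :: "'v \<Rightarrow> nat"
  assumes G: "pair_wf_digraph G" and f: "\<And>v. f v \<le> n"
    and mono: "{(u, v). f u = f v \<and> (u, v) \<in> adj G ^^ nat \<lfloor>s\<rfloor>}\<^sup>* \<subseteq> adj G ^^ b"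
    and sym: "sym (parcs G)"
  shows "\<exists>\<U>. (\<Union>i\<in>{1..n + 1}. \<Union>(\<U> i)) = pverts G \<and> (\<forall>i\<in>{1..n + 1}.
    r_disjoint (graph_dist G) s (\<U> i) \<and> bounded_family (graph_dist G) (real b + 1) (\<U> i))"
proof -
  let ?R = "{(u, v). f u = f v \<and> (u, v) \<in> adj G ^^ nat \<lfloor>s\<rfloor>}"
  define \<U> where "\<U> i = {{v \<in> pverts G. (u, v) \<in> ?R\<^sup>*} | u. u \<in> pverts G \<and> Suc (f u) = i}" for i
  have symG: "sym (adj G ^^ j)" for j
    using sym by (intro sym_relpow) (auto simp: sym_def)
  have symR: "(v, u) \<in> ?R\<^sup>*" if "(u, v) \<in> ?R\<^sup>*" for u v
  proof -
    have "sym (?R\<^sup>*)" using symG by (intro sym_rtrancl) (auto simp: sym_def)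
    then show ?thesis using that by (rule symD)
  qed
  have fR: "f u = f v" if "(u, v) \<in> ?R\<^sup>*" for u v
    using that by (induction rule: rtrancl_induct) auto
  have "(\<Union>i\<in>{1..n + 1}. \<Union>(\<U> i)) = pverts G"
  proof
    show "pverts G \<subseteq> (\<Union>i\<in>{1..n + 1}. \<Union>(\<U> i))"
    proof
      fix v assume "v \<in> pverts G"
      then have "v \<in> \<Union>(\<U> (Suc (f v)))" unfolding \<U>_def by blast
      moreover have "Suc (f v) \<in> {1..n + 1}" using f[of v] by simp
      ultimately show "v \<in> (\<Union>i\<in>{1..n + 1}. \<Union>(\<U> i))" by blast
    qed
  qed (auto simp: \<U>_def)
  moreover have "r_disjoint (graph_dist G) s (\<U> i)" for i
    unfolding r_disjoint_def
  proof (intro ballI impI)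
    fix A B a c assume AB: "A \<in> \<U> i" "B \<in> \<U> i" "A \<noteq> B" and a: "a \<in> A" and c: "c \<in> B"
    obtain u where u: "A = {v \<in> pverts G. (u, v) \<in> ?R\<^sup>*}" "Suc (f u) = i"
      using AB(1) unfolding \<U>_def by blast
    obtain w where w: "B = {v \<in> pverts G. (w, v) \<in> ?R\<^sup>*}" "Suc (f w) = i"
      using AB(2) unfolding \<U>_def by blast
    have ua: "(u, a) \<in> ?R\<^sup>*" and wc: "(w, c) \<in> ?R\<^sup>*" using a c u w by auto
    show "ereal s < graph_dist G a c"
    proof (rule ccontr)
      assume "\<not> ?thesis"
      then have "(a, c) \<in> adj G ^^ nat \<lfloor>s\<rfloor>" using graph_dist_leD[OF G] by (simp add: not_less)
      moreover have "f a = f c" using fR[OF ua] fR[OF wc] u(2) w(2) by simp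
      ultimately have "(a, c) \<in> ?R" by simp
      then have "(u, c) \<in> ?R\<^sup>*" using ua by (rule rtrancl_into_rtrancl[rotated])
      then have uw: "(u, w) \<in> ?R\<^sup>*" using symR[OF wc] by (rule rtrancl_trans)
      have "A = B" unfolding u(1) w(1) using uw symR[OF uw] rtrancl_trans[of _ _ ?R] by blast
      then show False using AB by simp
    qed
  qed
  moreover have "bounded_family (graph_dist G) (real b + 1) (\<U> i)" for i
    unfolding bounded_family_def
  proof
    fix A assume "A \<in> \<U> i"
    then obtain u where u: "A = {v \<in> pverts G. (u, v) \<in> ?R\<^sup>*}" unfolding \<U>_def by blast
    show "ediameter (graph_dist G) A \<le> ereal (real b + 1)"
      unfolding ediameter_def
    proof (intro SUP_least)
      fix x y assume "x \<in> A" "y \<in> A"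
      then have xy: "x \<in> pverts G" "(u, x) \<in> ?R\<^sup>*" "(u, y) \<in> ?R\<^sup>*" using u by auto
      have "(x, y) \<in> ?R\<^sup>*" using symR[OF xy(2)] xy(3) by (rule rtrancl_trans)
      then have "(x, y) \<in> adj G ^^ b" using mono by blast
      then show "graph_dist G x y \<le> ereal (real b + 1)"
        using graph_dist_leI[OF G _ xy(1)] by simp
    qed
  qed
  ultimately show ?thesis by blast
qed

subsection \<open>Colouring a bag\<close>

text \<open>The neighbour is part of the triple so that a pair lying in two adhesion sets gets two
  new vertices, as the disjointness in \<open>bag_extension\<close> demands.\<close>

definition link_triples ::
    "'v pair_pre_digraph \<Rightarrow> 't pair_pre_digraph \<Rightarrow> ('t \<Rightarrow> 'v set) \<Rightarrow> 't \<Rightarrow> nat \<Rightarrow> ('t \<times> 'v \<times> 'v) set" where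
  "link_triples G T X t j = {(t', u, v). (t, t') \<in> parcs T \<and> u \<in> X t \<inter> X t' \<and> v \<in> X t \<inter> X t' \<and>
    (u, v) \<in> adj G ^^ j}"

text \<open>With one new vertex for every pair of an adhesion set at distance at most \<open>j\<close> in \<open>G\<close>, the
  bag becomes coarsely isometric, at scale \<open>j\<close>, to the metric induced from \<open>G\<close>.\<close>

definition linked_bag ::
    "'v pair_pre_digraph \<Rightarrow> 't pair_pre_digraph \<Rightarrow> ('t \<Rightarrow> 'v set) \<Rightarrow> 't \<Rightarrow> nat \<Rightarrow>
     ('t \<times> 'v \<times> 'v \<Rightarrow> 'v) \<Rightarrow> 'v pair_pre_digraph" where
  "linked_bag G T X t j \<nu> = \<lparr> pverts = X t \<union> \<nu> ` link_triples G T X t j,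
    parcs = {(x, y) \<in> parcs G. x \<in> X t \<and> y \<in> X t}
      \<union> {(x, \<nu> (t', u, v)) | x t' u v. (t', u, v) \<in> link_triples G T X t j \<and> (x = u \<or> x = v)}
      \<union> {(\<nu> (t', u, v), x) | x t' u v. (t', u, v) \<in> link_triples G T X t j \<and> (x = u \<or> x = v)} \<rparr>"

lemma finite_link_triples:
  assumes "pair_graph G" "tree_decomposition G T X" "t \<in> pverts T"
  shows "finite (link_triples G T X t j)"
proof -
  interpret G: pair_graph G by fact
  have "pair_graph T" using tree_decompositionD(1)[OF assms(2)] by (simp add: undirected_tree_def)
  then interpret T: pair_graph T .
  have "X t \<subseteq> pverts G" using tree_decompositionD(2)[OF assms(2)] assms(3) by blast
  then have "link_triples G T X t j \<subseteq> pverts T \<times> pverts G \<times> pverts G"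
    using T.in_arcsD2 by (auto simp: link_triples_def)
  then show ?thesis
    by (rule finite_subset) (intro finite_cartesian_product T.pair_finite_verts G.pair_finite_verts)
qed

locale linking =
  fixes G :: "'v pair_pre_digraph" and T :: "'t pair_pre_digraph" and X t j \<nu>
  assumes G: "pair_graph G" and td: "tree_decomposition G T X" and t: "t \<in> pverts T"
    and inj: "inj_on \<nu> (link_triples G T X t j)"
    and new: "\<nu> ` link_triples G T X t j \<inter> pverts G = {}"
begin

abbreviation P where "P \<equiv> link_triples G T X t j"
abbreviation H where "H \<equiv> linked_bag G T X t j \<nu>"

lemma Xt: "X t \<subseteq> pverts G"
  using tree_decompositionD(2)[OF td] t by blast

lemma P_Xt: "(t', u, v) \<in> P \<Longrightarrow> u \<in> X t \<and> v \<in> X t"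
  by (auto simp: link_triples_def)

lemma \<nu>_notin: "x \<in> P \<Longrightarrow> \<nu> x \<notin> X t"
  using new Xt by blast

lemma pverts_H: "pverts H = X t \<union> \<nu> ` P"
  by (simp add: linked_bag_def)

lemma parcs_H: "parcs H = {(x, y) \<in> parcs G. x \<in> X t \<and> y \<in> X t}
      \<union> {(x, \<nu> (t', u, v)) | x t' u v. (t', u, v) \<in> P \<and> (x = u \<or> x = v)}
      \<union> {(\<nu> (t', u, v), x) | x t' u v. (t', u, v) \<in> P \<and> (x = u \<or> x = v)}"
  by (simp add: linked_bag_def)

lemma finite_P: "finite P"
  by (rule finite_link_triples[OF G td t])

lemma pair_graph_H: "pair_graph H"
proof -
  interpret G: pair_graph G by (rule G)
  have V: "x \<in> pverts H \<and> y \<in> pverts H \<and> x \<noteq> y \<and> (y, x) \<in> parcs H" if "(x, y) \<in> parcs H" for x y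
  proof -
    from that consider "(x, y) \<in> parcs G" "x \<in> X t" "y \<in> X t"
      | t' u v where "(t', u, v) \<in> P" "y = \<nu> (t', u, v)" "x = u \<or> x = v"
      | t' u v where "(t', u, v) \<in> P" "x = \<nu> (t', u, v)" "y = u \<or> y = v"
      unfolding parcs_H by blast
    then show ?thesis
    proof cases
      case 1
      then have "(y, x) \<in> parcs H" unfolding parcs_H using G.arcs_symmetric by simp
      then show ?thesis using 1 G.no_loops' unfolding pverts_H by blast
    next
      case (2 t' u v)
      then have "x \<in> X t" "y \<notin> X t" using P_Xt \<nu>_notin by blast+
      moreover have "(y, x) \<in> parcs H" unfolding parcs_H using 2 by blast
      ultimately show ?thesis unfolding pverts_H using 2 by blast
    next
      case (3 t' u v)
      then have "y \<in> X t" "x \<notin> X t" using P_Xt \<nu>_notin by blast+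
      moreover have "(y, x) \<in> parcs H" unfolding parcs_H using 3 by blast
      ultimately show ?thesis unfolding pverts_H using 3 by blast
    qed
  qed
  have finV: "finite (pverts H)"
    unfolding pverts_H using finite_P finite_subset[OF Xt G.pair_finite_verts] by simp
  have "parcs H \<subseteq> pverts H \<times> pverts H" using V by auto
  then have finA: "finite (parcs H)" by (rule finite_subset) (use finV in simp)
  show ?thesis
  proof
    fix e assume "e \<in> parcs H"
    then show "fst e \<in> pverts H" "snd e \<in> pverts H" "fst e \<noteq> snd e" using V[of "fst e" "snd e"] by auto
  next
    show "symmetric (with_proj H)"
      unfolding symmetric_def with_proj_simps using V by (auto intro: symI)
  qed (fact finV finA)+
qed

lemma bag_extension_H: "bag_extension G T X t H"
  unfolding bag_extension_def
proof (intro conjI exI[of _ "\<lambda>t'. \<nu> ` (P \<inter> {t'} \<times> UNIV)"] ballI)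
  show "pair_graph H" by (rule pair_graph_H)
  interpret G: pair_graph G by (rule G)
  interpret H: pair_graph H by (rule pair_graph_H)
  have arcs_t: "{e \<in> parcs G. fst e \<in> X t \<and> snd e \<in> X t} = {e \<in> parcs H. fst e \<in> X t \<and> snd e \<in> X t}"
  proof (rule set_eqI)
    fix e
    have "(x, y) \<in> parcs H \<and> x \<in> X t \<and> y \<in> X t \<longleftrightarrow> (x, y) \<in> parcs G \<and> x \<in> X t \<and> y \<in> X t" for x y
      unfolding parcs_H using \<nu>_notin by blast
    from this[of "fst e" "snd e"]
    show "e \<in> {e \<in> parcs G. fst e \<in> X t \<and> snd e \<in> X t} \<longleftrightarrow>
        e \<in> {e \<in> parcs H. fst e \<in> X t \<and> snd e \<in> X t}" by simp
  qed
  show "induced_subgraph (with_proj G \<restriction> X t) (with_proj H)"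
  proof (intro induced_subgraphI subgraphI)
    show "verts (with_proj G \<restriction> X t) \<subseteq> verts (with_proj H)" by (simp add: pverts_H)
    show "arcs (with_proj G \<restriction> X t) \<subseteq> arcs (with_proj H)"
      unfolding induce_subgraph_arcs with_proj_simps arcs_t by blast
    show "compatible (with_proj H) (with_proj G \<restriction> X t)" by (simp add: compatible_def)
    show "wf_digraph (with_proj H)" by (rule H.wf_digraph_axioms)
    show "wf_digraph (with_proj G \<restriction> X t)" by (rule G.wellformed_induce_subgraph)
    show "arcs (with_proj G \<restriction> X t) = {e \<in> arcs (with_proj H).
        tail (with_proj H) e \<in> verts (with_proj G \<restriction> X t) \<and>
        head (with_proj H) e \<in> verts (with_proj G \<restriction> X t)}"
      unfolding induce_subgraph_arcs induce_subgraph_verts with_proj_simps by (rule arcs_t)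
  qed
  show "disjoint_family_on (\<lambda>t'. \<nu> ` (P \<inter> {t'} \<times> UNIV)) (neighbours T t)"
    unfolding disjoint_family_on_def
  proof (intro ballI impI)
    fix a b :: 't assume "a \<noteq> b"
    then have "\<nu> ` ((P \<inter> {a} \<times> UNIV) \<inter> (P \<inter> {b} \<times> UNIV)) = {}" by auto
    then show "\<nu> ` (P \<inter> {a} \<times> UNIV) \<inter> \<nu> ` (P \<inter> {b} \<times> UNIV) = {}"
      using inj_on_image_Int[OF inj] by (metis Int_lower1)
  qed
  have "P = (\<Union>t'\<in>neighbours T t. P \<inter> {t'} \<times> UNIV)"
    by (auto simp: neighbours_def link_triples_def)
  then show "pverts H = X t \<union> (\<Union>t'\<in>neighbours T t. \<nu> ` (P \<inter> {t'} \<times> UNIV))"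
    unfolding pverts_H by (metis image_UN)
  fix t' assume "t' \<in> neighbours T t"
  show "\<nu> ` (P \<inter> {t'} \<times> UNIV) \<inter> X t = {}" using \<nu>_notin by auto
  fix w assume "w \<in> \<nu> ` (P \<inter> {t'} \<times> UNIV)"
  then obtain u v where w: "w = \<nu> (t', u, v)" "(t', u, v) \<in> P" by auto
  show "neighbours H w \<subseteq> X t \<inter> X t'"
  proof
    fix x assume "x \<in> neighbours H w"
    then have "(w, x) \<in> parcs H" by (simp add: neighbours_def)
    moreover have "w \<notin> X t" using w \<nu>_notin by blast
    ultimately obtain s a b where s: "(s, a, b) \<in> P" "w = \<nu> (s, a, b)" "x = a \<or> x = b"
      unfolding parcs_H using P_Xt by blast
    then have "(s, a, b) = (t', u, v)" using inj w by (metis inj_onD)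
    then show "x \<in> X t \<inter> X t'" using s by (auto simp: link_triples_def)
  qed
qed

text \<open>Retract each new vertex to the first vertex of its pair: an edge at a new vertex is
  stretched to at most \<open>j\<close>, an old edge keeps length 1, and \<open>Suc j\<close> bounds
  both.\<close>

lemma adj_H_dist:
  assumes "u \<in> X t" "v \<in> X t" "(u, v) \<in> adj H ^^ l" shows "(u, v) \<in> adj G ^^ (Suc j * l)"
proof -
  define g where "g x = (if x \<in> X t then x else fst (snd (inv_into P \<nu> x)))" for x
  have g\<nu>: "g (\<nu> (s, a, b)) = a" if "(s, a, b) \<in> P" for s a b
    using that \<nu>_notin[OF that] inv_into_f_f[OF inj that] by (simp add: g_def)
  have mono: "(x, y) \<in> adj G ^^ i \<Longrightarrow> i \<le> i' \<Longrightarrow> (x, y) \<in> adj G ^^ i'" for x y i i'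
    using relpow_mono_exp[of "adj G" i i'] by blast
  have symG: "sym (adj G ^^ i)" for i
    using pair_graph_sym[OF G] by (intro sym_relpow) (auto simp: sym_def)
  have link: "(x, a) \<in> adj G ^^ Suc j" "(a, x) \<in> adj G ^^ Suc j"
    if "(s, a, b) \<in> P" "x = a \<or> x = b" for s a b x
  proof -
    have "(a, x) \<in> adj G ^^ j"
      using that mono[of a a 0 j] by (auto simp: link_triples_def)
    then show "(a, x) \<in> adj G ^^ Suc j" by (rule mono) simp
    then show "(x, a) \<in> adj G ^^ Suc j" using symG by (metis symD)
  qed
  have edge: "(g x, g y) \<in> adj G ^^ Suc j" if xy: "(x, y) \<in> adj H" for x y
  proof -
    consider "x = y" | "(x, y) \<in> parcs G" "x \<in> X t" "y \<in> X t"
      | s a b where "(s, a, b) \<in> P" "y = \<nu> (s, a, b)" "x = a \<or> x = b"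
      | s a b where "(s, a, b) \<in> P" "x = \<nu> (s, a, b)" "y = a \<or> y = b"
      using xy unfolding parcs_H by blast
    then show ?thesis
    proof cases
      case 1 then show ?thesis using mono[of "g y" "g y" 0 "Suc j"] by simp
    next
      case 2 then show ?thesis using mono[of x y 1 "Suc j"] by (simp add: g_def)
    next
      case (3 s a b)
      then have "g x = x" using P_Xt by (auto simp: g_def)
      then show ?thesis using 3 g\<nu> link by metis
    next
      case (4 s a b)
      then have "g y = y" using P_Xt by (auto simp: g_def)
      then show ?thesis using 4 g\<nu> link by metis
    qed
  qed
  have "(g u, g v) \<in> adj G ^^ (Suc j * l)"
    using assms(3)
  proof (induction l arbitrary: v)
    case (Suc l)
    then obtain w where w: "(u, w) \<in> adj H ^^ l" "(w, v) \<in> adj H" by auto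
    have "Suc j * Suc l = Suc j * l + Suc j" by simp
    then show ?case using relpow_trans[OF Suc.IH[OF w(1)] edge[OF w(2)]] by metis
  qed simp
  then show ?thesis using assms(1,2) by (simp add: g_def)
qed

text \<open>A stretch of the walk outside \<open>X t\<close> stays in one branch of the tree at
  \<open>t\<close>. It leaves from and returns to the same adhesion set, at distance at most
  \<open>j\<close>, so two edges through a new vertex replace it.\<close>

lemma dist_adj_H:
  assumes "u \<in> X t" "v \<in> X t" "(u, v) \<in> adj G ^^ j" shows "(u, v) \<in> adj H ^^ (2 * j)"
proof -
  define X' where "X' a = (if a \<in> pverts T then X a else {})" for a
  obtain p m \<tau> where m: "m t = (0 :: nat)" and rb: "rooted_bags X' p m \<tau>"
    and par: "\<forall>a\<in>pverts T. m (p a) < m a \<longrightarrow> (a, p a) \<in> parcs T"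
    using tree_decomposition_rooted[OF td t] unfolding X'_def by blast
  interpret rooted_bags X' p m \<tau> by (rule rb)
  have symT: "sym (parcs T)"
    using tree_decompositionD(1)[OF td] by (intro pair_graph_sym) (simp add: undirected_tree_def)
  \<comment> \<open>Cutting exactly the edges at \<open>t\<close> makes \<open>rtop\<close> the map
    from a bag to the neighbour of \<open>t\<close> whose branch contains it.\<close>
  define top where "top = rtop (\<lambda>a _. p a = t)"
  have top_t: "top t = t" unfolding top_def using rtop_eq_self_or m by (metis not_less0)
  have top_eq_t: "a = t" if "top a = t" for a
    using that
  proof (induction "m a" arbitrary: a rule: less_induct)
    case less
    show ?case
    proof (rule ccontr)
      assume "a \<noteq> t"
      then have a: "m (p a) < m a" "top a = top (p a)"
        using rtop_eq_self_or[of "\<lambda>a _. p a = t" a] less.prems unfolding top_def by metis+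
      then have "p a = t" using less.hyps less.prems by metis
      then have "top a = a" unfolding top_def using a(1) by (subst rtop.simps) simp
      then show False using less.prems \<open>a \<noteq> t\<close> by simp
    qed
  qed
  have adh_top: "adh (top a) \<subseteq> X t \<inter> X (top a) \<and> (adh (top a) \<noteq> {} \<longrightarrow> (t, top a) \<in> parcs T)" for a
  proof (cases "adh (top a) = {}")
    case False
    then have s: "m (p (top a)) < m (top a)" "top a \<in> pverts T"
      by (auto simp: adh_def X'_def split: if_splits)
    have "p (top a) = t"
      using brk_rtop[of "\<lambda>a _. p a = t" "top a"] s(1) unfolding top_def by simp
    then show ?thesis
      using s par symT t by (auto simp: adh_def X'_def dest: symD)
  qed simp
  have home_t: "top (\<tau> v) = t" if "v \<in> X t" for v
  proof -
    have "v \<in> X' t" using that t by (simp add: X'_def)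
    then have "\<tau> v = t" using up[of v t] m by auto
    then show ?thesis using top_t by simp
  qed
  have bag: "\<exists>s. (x \<in> X t \<longrightarrow> s = t \<or> x \<in> adh s) \<and> (x \<notin> X t \<longrightarrow> s = top (\<tau> x) \<and> s \<noteq> t) \<and>
      (y \<in> X t \<longrightarrow> s = t \<or> y \<in> adh s) \<and> (y \<notin> X t \<longrightarrow> s = top (\<tau> y) \<and> s \<noteq> t) \<and> (\<exists>a. s = top a)"
    if xy: "(x, y) \<in> parcs G" for x y
  proof -
    obtain a where a: "a \<in> pverts T" "x \<in> X a" "y \<in> X a"
      using bspec[OF tree_decompositionD(3)[OF td] xy] by auto
    have "(z \<in> X t \<longrightarrow> top a = t \<or> z \<in> adh (top a)) \<and> (z \<notin> X t \<longrightarrow> top a = top (\<tau> z) \<and> top a \<noteq> t)"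
      if "z \<in> X a" for z
    proof -
      have h: "top (\<tau> z) = top a \<or> z \<in> adh (top a)"
        unfolding top_def using that a(1) by (intro home_or_adh) (simp add: X'_def)
      show ?thesis
      proof (cases "z \<in> X t")
        case True then show ?thesis using h home_t[OF True] by auto
      next
        case False
        then have "z \<notin> adh (top a)" "a \<noteq> t" using adh_top[of a] that by auto
        then show ?thesis using h False top_eq_t[of a] by auto
      qed
    qed
    from this[OF a(2)] this[OF a(3)] show ?thesis by (intro exI[of _ "top a"]) auto
  qed
  let ?A = "adj H"
  \<comment> \<open>\<open>z\<close> is the last vertex of \<open>X t\<close> before
    \<open>w\<close>, met after \<open>l\<close> steps. An excursion of any length costs two edges,
    which the bound \<open>2 * i\<close> affords.\<close>
  have "w \<in> X t \<and> (u, w) \<in> ?A ^^ (2 * i) \<or>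
      w \<notin> X t \<and> (\<exists>z l. z \<in> adh (top (\<tau> w)) \<and> l \<le> i \<and> (u, z) \<in> ?A ^^ (2 * l) \<and>
        (z, w) \<in> adj G ^^ (i - l))"
    if "(u, w) \<in> adj G ^^ i" "i \<le> j" for w i
    using that
  proof (induction i arbitrary: w)
    case 0 then show ?case using assms(1) by simp
  next
    case (Suc i)
    then obtain w' where w': "(u, w') \<in> adj G ^^ i" "(w', w) \<in> adj G" by auto
    have "i \<le> j" using Suc.prems by simp
    note IH = Suc.IH[OF w'(1) this]
    have Amono: "(x, y) \<in> ?A ^^ b" if "(x, y) \<in> ?A ^^ a" "a \<le> b" for x y a b
      using relpow_mono_exp[of ?A a b] that by blast
    show ?case
    proof (cases "w' = w")
      case True
      from IH show ?thesis
      proof (elim disjE conjE exE)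
        assume "(u, w') \<in> ?A ^^ (2 * i)" "w' \<in> X t"
        then show ?thesis using Amono[of u w' "2 * i" "2 * Suc i"] True by simp
      next
        fix z l assume z: "w' \<notin> X t" "z \<in> adh (top (\<tau> w'))" "l \<le> i" "(u, z) \<in> ?A ^^ (2 * l)"
          "(z, w') \<in> adj G ^^ (i - l)"
        have "i - l \<le> Suc i - l" by (intro diff_le_mono) simp
        then have "(z, w') \<in> adj G ^^ (Suc i - l)"
          using relpow_mono_exp[OF Un_upper1] z(5) by blast
        then show ?thesis using z True le_SucI by blast
      qed
    next
      case False
      then have e: "(w', w) \<in> parcs G" using w'(2) by simp
      obtain s where s: "w' \<in> X t \<longrightarrow> s = t \<or> w' \<in> adh s" "w' \<notin> X t \<longrightarrow> s = top (\<tau> w') \<and> s \<noteq> t"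
        "w \<in> X t \<longrightarrow> s = t \<or> w \<in> adh s" "w \<notin> X t \<longrightarrow> s = top (\<tau> w) \<and> s \<noteq> t" "\<exists>a. s = top a"
        using bag[OF e] by blast
      from IH show ?thesis
      proof (elim disjE conjE exE)
        assume A: "(u, w') \<in> ?A ^^ (2 * i)" "w' \<in> X t"
        show ?thesis
        proof (cases "w \<in> X t")
          case True
          then have "(w', w) \<in> ?A" using e A(2) unfolding parcs_H by simp
          then have "(u, w) \<in> ?A ^^ Suc (2 * i)" using A(1) by (intro relpow_Suc_I)
          then show ?thesis using Amono[of u w "Suc (2 * i)" "2 * Suc i"] True by simp
        next
          case False
          then have "w' \<in> adh (top (\<tau> w))" using s(1,4) A(2) by metis
          moreover have "(w', w) \<in> adj G ^^ (Suc i - i)" using w'(2) by simp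
          ultimately show ?thesis using A(1) False le_SucI[OF le_refl, of i] by blast
        qed
      next
        fix z l assume z: "w' \<notin> X t" "z \<in> adh (top (\<tau> w'))" "l \<le> i" "(u, z) \<in> ?A ^^ (2 * l)"
          "(z, w') \<in> adj G ^^ (i - l)"
        have "(z, w) \<in> adj G ^^ Suc (i - l)" using z(5) w'(2) by (rule relpow_Suc_I)
        then have zw: "(z, w) \<in> adj G ^^ (Suc i - l)" using z(3) by (simp add: Suc_diff_le)
        show ?thesis
        proof (cases "w \<in> X t")
          case False
          then show ?thesis using s z zw le_SucI by metis
        next
          case True
          then have "z \<in> adh s" "w \<in> adh s" using s z by auto
          moreover obtain a where "s = top a" using s by blast
          ultimately have zs: "z \<in> X t \<inter> X s" "w \<in> X t \<inter> X s" "(t, s) \<in> parcs T"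
            using adh_top[of a] by blast+
          have "Suc i - l \<le> j" using Suc.prems(2) by simp
          then have "(z, w) \<in> adj G ^^ j" using relpow_mono_exp[OF Un_upper1] zw by blast
          then have "(s, z, w) \<in> P" using zs by (simp add: link_triples_def)
          then have "(z, \<nu> (s, z, w)) \<in> ?A" "(\<nu> (s, z, w), w) \<in> ?A" unfolding parcs_H by blast+
          then have "(u, w) \<in> ?A ^^ Suc (Suc (2 * l))" using z(4) by (intro relpow_Suc_I)
          then show ?thesis using Amono[of u w "Suc (Suc (2 * l))" "2 * Suc i"] z(3) True by simp
        qed
      qed
    qed
  qed
  from this[OF assms(3) le_refl] show ?thesis using assms(2) by blast
qed

lemma bag_colouring:
  assumes cf: "control_function k (pverts H) (graph_dist H) D" and "k \<le> n"
  shows "\<exists>f :: 'v \<Rightarrow> nat. (\<forall>v. f v \<le> n) \<and>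
    {(u, v). u \<in> X t \<and> v \<in> X t \<and> f u = f v \<and> (u, v) \<in> adj G ^^ j}\<^sup>*
      \<subseteq> adj G ^^ (Suc j * nat \<lfloor>D (real (2 * j + 1))\<rfloor>)"
proof -
  interpret H: pair_graph H by (rule pair_graph_H)
  \<comment> \<open>\<open>dist_adj_H\<close> gives \<open>2 * j\<close>; the extra 1 makes the
    scale positive when \<open>j = 0\<close>.\<close>
  let ?s = "real (2 * j + 1)"
  have "0 < ?s" by simp
  from control_function_colouring[OF cf this] obtain f :: "'v \<Rightarrow> nat" where f: "\<forall>v. f v \<le> k" and
    fD: "\<forall>u v. u \<in> pverts H \<longrightarrow>
      (u, v) \<in> {(u, v). u \<in> pverts H \<and> v \<in> pverts H \<and> f u = f v \<and> graph_dist H u v \<le> ereal ?s}\<^sup>*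
      \<longrightarrow> graph_dist H u v \<le> ereal (D ?s)" by (elim exE conjE)
  let ?R = "{(u, v). u \<in> X t \<and> v \<in> X t \<and> f u = f v \<and> (u, v) \<in> adj G ^^ j}"
  have "?R \<subseteq> {(u, v). u \<in> pverts H \<and> v \<in> pverts H \<and> f u = f v \<and> graph_dist H u v \<le> ereal ?s}"
  proof (clarify)
    fix u v assume uv: "u \<in> X t" "v \<in> X t" "f u = f v" "(u, v) \<in> adj G ^^ j"
    have "u \<in> pverts H" "v \<in> pverts H" using uv by (auto simp: pverts_H)
    moreover have "graph_dist H u v \<le> ereal ?s"
      by (rule graph_dist_leI[OF H.pair_wf_digraph dist_adj_H[OF uv(1,2,4)]])
        (use \<open>u \<in> pverts H\<close> in simp_all)
    ultimately show "u \<in> pverts H \<and> v \<in> pverts H \<and> f u = f v \<and> graph_dist H u v \<le> ereal ?s"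
      using uv by simp
  qed
  note R = rtrancl_mono[OF this]
  have "?R\<^sup>* \<subseteq> adj G ^^ (Suc j * nat \<lfloor>D ?s\<rfloor>)"
  proof (rule subrelI)
    fix u v assume uv: "(u, v) \<in> ?R\<^sup>*"
    show "(u, v) \<in> adj G ^^ (Suc j * nat \<lfloor>D ?s\<rfloor>)"
    proof (cases "u = v")
      case True then show ?thesis using relpow_mono_exp[of "adj G" 0] by auto
    next
      case False
      then have "(u, v) \<in> ?R\<^sup>+" using uv by (simp add: rtrancl_eq_or_trancl)
      then have X: "u \<in> X t" "v \<in> X t" by (auto elim: tranclE converse_tranclE)
      then have "u \<in> pverts H" by (simp add: pverts_H)
      then have "graph_dist H u v \<le> ereal (D ?s)" using fD R uv by blast
      then have "(u, v) \<in> adj H ^^ nat \<lfloor>D ?s\<rfloor>" using graph_dist_leD[OF H.pair_wf_digraph] by blast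
      then show ?thesis by (rule adj_H_dist[OF X])
    qed
  qed
  moreover have "\<forall>v. f v \<le> n" using f \<open>k \<le> n\<close> by (meson le_trans)
  ultimately show ?thesis by blast
qed

end

lemma fine_colouring_bag:
  fixes G :: "'v::infinite pair_pre_digraph"
  assumes G: "pair_graph G" and td: "tree_decomposition G T X" and t: "t \<in> pverts T"
    and ext: "\<And>H. bag_extension G T X t H \<Longrightarrow> control_function k (pverts H) (graph_dist H) D"
    and "k \<le> n"
  shows "fine_colouring n (adj G) (\<lambda>j. Suc j * nat \<lfloor>D (real (2 * j + 1))\<rfloor>) (X t)"
  unfolding fine_colouring_def
proof
  fix j
  let ?P = "link_triples G T X t j"
  interpret G: pair_graph G by (rule G)
  have finP: "finite ?P" by (rule finite_link_triples[OF G td t])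
  have "infinite (- pverts G)"
    using G.pair_finite_verts infinite_UNIV by (metis finite_compl)
  then obtain B where B: "finite B" "card B = card ?P" "B \<subseteq> - pverts G"
    using infinite_arbitrarily_large by blast
  then obtain \<nu> where \<nu>: "bij_betw \<nu> ?P B" using finP by (metis finite_same_card_bij)
  interpret linking G T X t j \<nu>
    by unfold_locales (use G td t \<nu> B in \<open>auto simp: bij_betw_def\<close>)
  show "\<exists>f. (\<forall>v. f v \<le> n) \<and> {(u, v). u \<in> X t \<and> v \<in> X t \<and> f u = f v \<and> (u, v) \<in> adj G ^^ j}\<^sup>*
      \<subseteq> adj G ^^ (Suc j * nat \<lfloor>D (real (2 * j + 1))\<rfloor>)"
    by (rule bag_colouring[OF ext[OF bag_extension_H] \<open>k \<le> n\<close>])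
qed

subsection \<open>The theorem\<close>

lemma Inf_enat_in:
  fixes A :: "enat set"
  assumes "A \<noteq> {}" shows "Inf A \<in> A"
proof -
  obtain x where "x \<in> A" using assms by blast
  then have "(LEAST x. x \<in> A) \<in> A" by (rule LeastI)
  then show ?thesis using assms by (simp add: Inf_enat_def)
qed

lemma asdim_attained:
  assumes "asdim \<C> \<noteq> \<infinity>"
  shows "\<exists>k D. asdim \<C> = enat k \<and>
    (\<forall>G\<in>\<C>. control_function k (pverts G) (graph_dist G) D)"
proof -
  let ?S = "{enat n | n. \<exists>D. \<forall>G\<in>\<C>. control_function n (pverts G) (graph_dist G) D}"
  have "?S \<noteq> {}"
  proof
    assume e: "?S = {}"
    show False using assms unfolding asdim_def e by (simp add: Inf_enat_def)
  qed
  then have "asdim \<C> \<in> ?S" unfolding asdim_def by (rule Inf_enat_in)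
  then show ?thesis by (elim CollectE exE conjE) (intro exI conjI)
qed

lemma card_le_adhesion:
  assumes "pair_graph T" "(a, b) \<in> parcs T" shows "card (X a \<inter> X b) \<le> adhesion T X"
proof -
  interpret pair_graph T by fact
  have "{card (X t \<inter> X t') | t t'. (t, t') \<in> parcs T} \<subseteq> (\<lambda>e. card (X (fst e) \<inter> X (snd e))) ` parcs T"
    by force
  then have "finite {card (X t \<inter> X t') | t t'. (t, t') \<in> parcs T}"
    using pair_finite_arcs by (rule finite_subset[OF _ finite_imageI])
  then show ?thesis unfolding adhesion_def using assms(2) by (intro Max_ge) auto
qed

theorem theorem3p1:
  fixes \<C> \<G> :: "'v::infinite pair_pre_digraph set" and \<theta> :: nat
  assumes "graph_class \<C>" and "hereditary \<C>"
    and "\<theta> \<ge> 1"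
    and "graph_class \<G>"
    and "\<And>G. G \<in> \<G> \<Longrightarrow>
           \<exists>(T :: nat pair_pre_digraph) (X :: nat \<Rightarrow> 'v set).
             tree_decomposition G T X \<and> adhesion T X \<le> \<theta> \<and>
             (\<forall>t\<in>pverts T. \<forall>H. bag_extension G T X t H \<longrightarrow> H \<in> \<C>)"
  shows "asdim \<G> \<le> max (asdim \<C>) 1"
proof (cases "asdim \<C> = \<infinity>")
  case False
  from asdim_attained[OF this] obtain k D where k: "asdim \<C> = enat k"
    and D: "\<forall>H\<in>\<C>. control_function k (pverts H) (graph_dist H) D" by (elim exE conjE)
  define n where "n = max k 1"
  have n: "1 \<le> n" "k \<le> n" by (auto simp: n_def)
  define D' where "D' j = Suc j * nat \<lfloor>D (real (2 * j + 1))\<rfloor>" for j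
  have "\<exists>b. \<forall>G\<in>\<G>. \<exists>f. (\<forall>v. f v \<le> n) \<and>
      {(u, v). f u = f v \<and> (u, v) \<in> adj G ^^ r}\<^sup>* \<subseteq> adj G ^^ b" for r
  proof -
    \<comment> \<open>At the outset both relations are the adjacency of \<open>G\<close>, hence
      \<open>R = 1\<close>.\<close>
    from tree_like_colouring[OF n(1), where 't = nat and 'v = 'v, of 1 \<theta> D' r]
    obtain b where b: "\<And>E0 E (X :: nat \<Rightarrow> 'v set) p m \<tau>. rooted_bags X p m \<tau> \<Longrightarrow>
      Id \<subseteq> E0 \<Longrightarrow> sym E0 \<Longrightarrow> Id \<subseteq> E \<Longrightarrow> sym E \<Longrightarrow> E \<subseteq> E0 ^^ 1 \<Longrightarrow>
      (\<forall>(x, y)\<in>E. x \<noteq> y \<longrightarrow> (\<exists>a. x \<in> X a \<and> y \<in> X a)) \<Longrightarrow>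
      (\<forall>a. finite (rooted_bags.adh X p m a) \<and> card (rooted_bags.adh X p m a) \<le> \<theta>) \<Longrightarrow>
      (\<forall>a. fine_colouring n E0 D' (X a)) \<Longrightarrow>
      \<exists>f. (\<forall>v. f v \<le> n) \<and> {(u, v). f u = f v \<and> (u, v) \<in> E ^^ r}\<^sup>* \<subseteq> E0 ^^ b"
      by blast
    have "\<exists>f. (\<forall>v. f v \<le> n) \<and> {(u, v). f u = f v \<and> (u, v) \<in> adj G ^^ r}\<^sup>* \<subseteq> adj G ^^ b"
      if GG: "G \<in> \<G>" for G
    proof -
      have G: "pair_graph G" using assms(4) GG by (simp add: graph_class_def)
      interpret G: pair_graph G by (rule G)
      obtain T :: "nat pair_pre_digraph" and X where td: "tree_decomposition G T X"
        and ad: "adhesion T X \<le> \<theta>"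
        and ext: "\<forall>t\<in>pverts T. \<forall>H. bag_extension G T X t H \<longrightarrow> H \<in> \<C>"
        using assms(5)[OF GG] by blast
      have T: "pair_graph T" "Digraph_Component.connected (with_proj T)"
        using tree_decompositionD(1)[OF td] by (simp_all add: undirected_tree_def)
      obtain t where t: "t \<in> pverts T"
        using T(2) unfolding Digraph_Component.connected_def strongly_connected_def by auto
      define X' where "X' a = (if a \<in> pverts T then X a else {})" for a
      obtain p m \<tau> where rb: "rooted_bags X' p m \<tau>"
        and par: "\<forall>a\<in>pverts T. m (p a) < m a \<longrightarrow> (a, p a) \<in> parcs T"
        using tree_decomposition_rooted[OF td t] unfolding X'_def by blast
      have X'V: "X' a \<subseteq> pverts G" for a
        using tree_decompositionD(2)[OF td] by (simp add: X'_def)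
      have symA: "sym (adj G)" using pair_graph_sym[OF G] by (auto simp: sym_def)
      show ?thesis
      proof (rule b[OF rb Un_upper1 symA Un_upper1 symA])
        show "adj G \<subseteq> adj G ^^ 1" by simp
        show "\<forall>(x, y)\<in>adj G. x \<noteq> y \<longrightarrow> (\<exists>a. x \<in> X' a \<and> y \<in> X' a)"
        proof
          fix e assume e: "e \<in> adj G"
          obtain x y where xy: "e = (x, y)" by (cases e)
          have "\<exists>a. x \<in> X' a \<and> y \<in> X' a" if "x \<noteq> y"
          proof -
            have "(x, y) \<in> parcs G" using e xy that by simp
            from bspec[OF tree_decompositionD(3)[OF td] this]
            obtain a where "a \<in> pverts T" "x \<in> X a" "y \<in> X a" by auto
            then show ?thesis by (intro exI[of _ a]) (simp add: X'_def)
          qed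
          then show "case e of (x, y) \<Rightarrow> x \<noteq> y \<longrightarrow> (\<exists>a. x \<in> X' a \<and> y \<in> X' a)" using xy by simp
        qed
        show "\<forall>a. finite (rooted_bags.adh X' p m a) \<and> card (rooted_bags.adh X' p m a) \<le> \<theta>"
        proof
          fix a
          note adh = rooted_bags.adh_def[OF rb, of a]
          show "finite (rooted_bags.adh X' p m a) \<and> card (rooted_bags.adh X' p m a) \<le> \<theta>"
          proof (cases "rooted_bags.adh X' p m a = {}")
            case False
            then have a: "m (p a) < m a" "a \<in> pverts T" "p a \<in> pverts T"
              unfolding adh by (auto simp: X'_def split: if_splits)
            then have "rooted_bags.adh X' p m a = X a \<inter> X (p a)" unfolding adh by (simp add: X'_def)
            moreover have "card (X a \<inter> X (p a)) \<le> \<theta>"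
              using card_le_adhesion[OF T(1), of a "p a" X] par a ad by auto
            moreover have "finite (X a)"
              using finite_subset[OF X'V[of a] G.pair_finite_verts] a(2) by (simp add: X'_def)
            ultimately show ?thesis by simp
          qed simp
        qed
        show "\<forall>a. fine_colouring n (adj G) D' (X' a)"
        proof
          fix a
          show "fine_colouring n (adj G) D' (X' a)"
          proof (cases "a \<in> pverts T")
            case True
            have "fine_colouring n (adj G) D' (X a)"
              unfolding D'_def
              by (rule fine_colouring_bag[OF G td True _ n(2)]) (use ext D True in blast)
            then show ?thesis using True by (simp add: X'_def)
          next
            case False
            \<comment> \<open>Indices outside the tree carry the empty bag, which inherits a
              colouring from the bag of \<open>t\<close>.\<close>
            have "fine_colouring n (adj G) D' (X t)"
              unfolding D'_def
              by (rule fine_colouring_bag[OF G td t _ n(2)]) (use ext D t in blast)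
            then show ?thesis by (rule fine_colouring_mono) (simp add: X'_def False)
          qed
        qed
      qed
    qed
    then show ?thesis by blast
  qed
  then have "\<forall>r. \<exists>b. \<forall>G\<in>\<G>. \<exists>f. (\<forall>v. f v \<le> n) \<and>
      {(u, v). f u = f v \<and> (u, v) \<in> adj G ^^ r}\<^sup>* \<subseteq> adj G ^^ b" by (rule allI)
  from choice[OF this] obtain b where b: "\<And>r G. G \<in> \<G> \<Longrightarrow> \<exists>f. (\<forall>v. f v \<le> n) \<and>
      {(u, v). f u = f v \<and> (u, v) \<in> adj G ^^ r}\<^sup>* \<subseteq> adj G ^^ b r" by blast
  have "control_function n (pverts G) (graph_dist G) (\<lambda>s. real (b (nat \<lfloor>s\<rfloor>)) + 1)"
    if GG: "G \<in> \<G>" for G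
    unfolding control_function_def
  proof (intro allI impI conjI)
    fix s :: real
    have G: "pair_graph G" using assms(4) GG by (simp add: graph_class_def)
    then interpret G: pair_graph G .
    obtain f where f: "\<forall>v. f v \<le> n"
      "{(u, v). f u = f v \<and> (u, v) \<in> adj G ^^ nat \<lfloor>s\<rfloor>}\<^sup>* \<subseteq> adj G ^^ b (nat \<lfloor>s\<rfloor>)"
      using b[OF GG] by blast
    show "\<exists>\<U>. (\<Union>i\<in>{1..n + 1}. \<Union>(\<U> i)) = pverts G \<and> (\<forall>i\<in>{1..n + 1}.
        r_disjoint (graph_dist G) s (\<U> i) \<and>
        bounded_family (graph_dist G) (real (b (nat \<lfloor>s\<rfloor>)) + 1) (\<U> i))"
      using G.pair_wf_digraph f(1)[rule_format] f(2) pair_graph_sym[OF G] by (rule colouring_control)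
  qed simp
  then have "asdim \<G> \<le> enat n" unfolding asdim_def by (intro Inf_lower) blast
  also have "enat n = max (asdim \<C>) 1"
    by (simp add: n_def k one_enat_def max_def)
  finally show ?thesis .
qed simp

end
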